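(* Fix a constant $\kappa\in(0,1)$ (for instance $\kappa=\tfrac12$). There is a constant $c>0$ (depending only on $\kappa$) such that the following holds. Consider a sequence of stochastic block models with two communities of sizes $n_1,n_2$, within-community parameters $\theta_1,\theta_2$ and between-community parameter $\rho$ with $\theta_1,\theta_2>\rho\ge 0$ (all depending on the index of the sequence), and write $n_{\min},n_{\max}$ for the minimum and maximum of $n_1,n_2$ and $\theta_{\min},\theta_{\max}$ for the minimum and maximum of $\theta_1,\theta_2$. Assume that $n_{\min}\to\infty$, and that along the sequence $\theta_{\max}<\kappa$ and $$c\,(\theta_{\min}-\rho)>\Big(\frac{\theta_{\max}}{\theta_{\min}}\Big)^{\frac73}\Big(\frac{n_{\max}}{n_{\min}}\Big)^{2}\max\Big\{n_{\min}^{-\frac13}\theta_{\max}^{\frac12}(\log n_{\min})^{\frac16},\ n_{\min}^{-\frac16}\theta_{\max}^{\frac56}(\log n_{\min})^{\frac16}\Big\}.$$ Then $\mathrm{AWCD}_1$ achieves consistent exact recovery: there are thresholds $\lambda$ (depending on the index of the sequence) such that its output $W$ satisfies $\mathbb P(\forall\, i,j:\ W_{ij}=W^*_{ij})\to1$.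
   Context: Model. The stochastic block model here is the random simple undirected graph on a vertex set partitioned into two communities $\mathcal C_1^*,\mathcal C_2^*$ of deterministic sizes $n_1,n_2$, whose edges are independent Bernoulli variables with mean $\theta_\alpha$ for pairs of distinct vertices both in $\mathcal C_\alpha^*$ ($\alpha=1,2$) and mean $\rho$ for pairs in different communities. $\mathcal Y$ is its symmetric $0/1$ adjacency matrix (zero diagonal). $W^*_{ij}=1$ if $i,j$ belong to the same community and $W^*_{ij}=0$ otherwise. Algorithm $\mathrm{AWCD}_1$ (one step, input $\mathcal Y$ and a threshold $\lambda\in\mathbb R$). Let $\mathcal C_i=\{j:\mathcal Y_{ij}=1\}$. For all vertices $i,j$ define $$S_{ij}=(\mathcal Y\mathcal Y\mathcal Y)_{ij}-\mathbb 1(\mathcal Y_{ij}=1)\,(|\mathcal C_i|+|\mathcal C_j|-1),\qquad N_{ij}=|\mathcal C_i|\,\big(|\mathcal C_j|-\mathbb 1(i=j)\big),$$ $$\widetilde\theta_{ij}=\frac{S_{ij}}{N_{ij}},\qquad \widetilde\theta_{i\lor j}=\frac{S_{ii}+2S_{ij}+S_{jj}}{N_{ii}+2N_{ij}+N_{jj}},$$ $$T_{ij}=N_{ii}\,\mathcal K(\widetilde\theta_{ii},\widetilde\theta_{i\lor j})+N_{jj}\,\mathcal K(\widetilde\theta_{jj},\widetilde\theta_{i\lor j})+N_{ij}\,\mathcal K(\widetilde\theta_{ij},\widetilde\theta_{i\lor j}),$$ where $\mathcal K(p,q)=p\log\frac pq+(1-p)\log\frac{1-p}{1-q}$ is the Kullback–Leibler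 divergence between Bernoulli distributions with means $p$ and $q$ ($0\log0=0$). Output: $W_{ij}=\mathbb 1(T_{ij}\le\lambda)$. Convention: if $T_{ij}$ is undefined (a denominator vanishes or an estimator lies outside $[0,1]$), put $T_{ij}=0$. The threshold may depend on the model parameters and community sizes. *)

theory Defs
  imports "HOL-Probability.Probability"
begin

text \<open>Matrices indexed by a finite vertex set \<open>V\<close> of naturals are functions
  \<open>nat \<Rightarrow> nat \<Rightarrow> real\<close>; only their entries in \<open>V \<times> V\<close> matter.\<close>

type_synonym rmatrix = "nat \<Rightarrow> nat \<Rightarrow> real"

subsection \<open>Stochastic block model with two communities\<close>

definition vertex_pairs :: "nat set \<Rightarrow> nat set set" where
  "vertex_pairs V = {e. e \<subseteq> V \<and> card e = 2}"

definition edge_prob ::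
    "nat set \<Rightarrow> nat set \<Rightarrow> real \<Rightarrow> real \<Rightarrow> real \<Rightarrow> nat set \<Rightarrow> real" where
  "edge_prob C1 C2 \<theta>1 \<theta>2 \<rho> e =
     (if e \<subseteq> C1 then \<theta>1 else if e \<subseteq> C2 then \<theta>2 else \<rho>)"

definition adjacency_matrix :: "nat set \<Rightarrow> (nat set \<Rightarrow> bool) \<Rightarrow> rmatrix" where
  "adjacency_matrix V g i j = of_bool ({i, j} \<in> vertex_pairs V \<and> g {i, j})"

text \<open>The law of the adjacency matrix. The unordered pairs index independent
  Bernoulli variables; \<open>bernoulli_pmf\<close> has the intended mean only for parameters
  in \<open>[0, 1]\<close>.\<close>

definition sbm_pmf ::
    "nat set \<Rightarrow> nat set \<Rightarrow> real \<Rightarrow> real \<Rightarrow> real \<Rightarrow> rmatrix pmf" where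
  "sbm_pmf C1 C2 \<theta>1 \<theta>2 \<rho> =
     map_pmf (adjacency_matrix (C1 \<union> C2))
       (Pi_pmf (vertex_pairs (C1 \<union> C2)) False
          (\<lambda>e. bernoulli_pmf (edge_prob C1 C2 \<theta>1 \<theta>2 \<rho> e)))"

definition true_weight :: "nat set \<Rightarrow> nat set \<Rightarrow> rmatrix" where
  "true_weight C1 C2 i j = of_bool ((i \<in> C1 \<and> j \<in> C1) \<or> (i \<in> C2 \<and> j \<in> C2))"

subsection \<open>One step of AWCD\<close>

definition neighbours :: "nat set \<Rightarrow> rmatrix \<Rightarrow> nat \<Rightarrow> nat set" where
  "neighbours V Y i = {j \<in> V. Y i j = 1}"

definition awcd_S :: "nat set \<Rightarrow> rmatrix \<Rightarrow> rmatrix" where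
  "awcd_S V Y i j =
     (\<Sum>a\<in>V. \<Sum>b\<in>V. Y i a * Y a b * Y b j)
       - of_bool (Y i j = 1)
           * (real (card (neighbours V Y i)) + real (card (neighbours V Y j)) - 1)"

definition awcd_N :: "nat set \<Rightarrow> rmatrix \<Rightarrow> rmatrix" where
  "awcd_N V Y i j =
     real (card (neighbours V Y i)) * (real (card (neighbours V Y j)) - of_bool (i = j))"

definition awcd_theta :: "nat set \<Rightarrow> rmatrix \<Rightarrow> rmatrix" where
  "awcd_theta V Y i j = awcd_S V Y i j / awcd_N V Y i j"

definition awcd_N_join :: "nat set \<Rightarrow> rmatrix \<Rightarrow> rmatrix" where
  "awcd_N_join V Y i j = awcd_N V Y i i + 2 * awcd_N V Y i j + awcd_N V Y j j"

definition awcd_theta_join :: "nat set \<Rightarrow> rmatrix \<Rightarrow> rmatrix" where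
  "awcd_theta_join V Y i j =
     (awcd_S V Y i i + 2 * awcd_S V Y i j + awcd_S V Y j j) / awcd_N_join V Y i j"

text \<open>A vanishing factor \<open>p\<close> or \<open>1 - p\<close> gives \<open>0 log 0 = 0\<close>. The infinite values
  (\<open>q = 0 < p\<close> or \<open>p < 1 = q\<close>) are not represented. They do not arise below:
  on a simple graph \<open>0 \<le> S \<le> N\<close> entrywise, so a pooled estimator equal to 0 or 1
  forces the three individual estimators to have the same value.\<close>

definition bernoulli_KL :: "real \<Rightarrow> real \<Rightarrow> real" where
  "bernoulli_KL p q = p * ln (p / q) + (1 - p) * ln ((1 - p) / (1 - q))"

definition awcd_defined :: "nat set \<Rightarrow> rmatrix \<Rightarrow> nat \<Rightarrow> nat \<Rightarrow> bool" where
  "awcd_defined V Y i j \<longleftrightarrow>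
     awcd_N V Y i i \<noteq> 0 \<and> awcd_N V Y j j \<noteq> 0 \<and> awcd_N V Y i j \<noteq> 0 \<and>
     awcd_N_join V Y i j \<noteq> 0 \<and>
     awcd_theta V Y i i \<in> {0..1} \<and> awcd_theta V Y j j \<in> {0..1} \<and>
     awcd_theta V Y i j \<in> {0..1} \<and> awcd_theta_join V Y i j \<in> {0..1}"

definition awcd_T :: "nat set \<Rightarrow> rmatrix \<Rightarrow> rmatrix" where
  "awcd_T V Y i j =
     (if awcd_defined V Y i j then
        awcd_N V Y i i * bernoulli_KL (awcd_theta V Y i i) (awcd_theta_join V Y i j)
        + awcd_N V Y j j * bernoulli_KL (awcd_theta V Y j j) (awcd_theta_join V Y i j)
        + awcd_N V Y i j * bernoulli_KL (awcd_theta V Y i j) (awcd_theta_join V Y i j)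
      else 0)"

definition awcd1 :: "nat set \<Rightarrow> real \<Rightarrow> rmatrix \<Rightarrow> rmatrix" where
  "awcd1 V thr Y i j = of_bool (awcd_T V Y i j \<le> thr)"

end

theory Submission
  imports Defs
begin

text \<open>Let \<open>x\<close> be the fraction of the neighbours of \<open>i\<close> that lie in the first block, and \<open>y\<close> that of
  \<open>j\<close>. Given the two neighbourhoods, the estimator \<open>S\<^sub>i\<^sub>j / N\<^sub>i\<^sub>j\<close> concentrates at the symmetric bilinear form
  \<open>B x y = x y \<theta>1 + (x (1 - y) + (1 - x) y) \<rho> + (1 - x) (1 - y) \<theta>2\<close>, and
  \<open>B x x + B y y - 2 B x y = (x - y)\<^sup>2 (\<theta>1 + \<theta>2 - 2 \<rho>)\<close>. Within a block \<open>x \<approx> y\<close>, so the three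
  estimators agree up to an error \<open>\<epsilon>\<close>; across blocks \<open>x - y\<close> is of order
  \<open>n (s - \<rho>) / (N t)\<close>, where \<open>n, N, s, t\<close> denote \<open>nmin, nmax, \<theta>min, \<theta>max\<close>, so that the second
  difference is at least \<open>\<Delta> = n\<^sup>2 (s - \<rho>)^3 / (8 N\<^sup>2 t\<^sup>2)\<close>. Quadratic upper and lower bounds for
  the relative entropy turn these into bounds on \<open>T\<close>, and the separation condition makes \<open>\<epsilon>\<close> a small
  multiple of \<open>\<Delta>\<close>. The fluctuations come from Chernoff bounds for sums of independent edges: the sum
  \<open>S\<^sub>i\<^sub>j\<close> is treated conditionally on the edges that touch \<open>i\<close> or \<open>j\<close>, since its remaining edges are
  independent of these.\<close>

section \<open>Chernoff bounds for independent edges\<close>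

lemma exp_le_quadratic:
  fixes x :: real
  assumes "\<bar>x\<bar> \<le> 1"
  shows "exp x \<le> 1 + x + x\<^sup>2"
proof (cases "x \<ge> 0")
  case True
  then show ?thesis using assms exp_bound[of x] by simp
next
  case False
  define y where "y = - x"
  have y: "0 < y" "y \<le> 1" using False assms by (auto simp: y_def)
  \<comment> \<open>The product equals \<open>1 + y^3\<close>. With
    \<open>1 + y \<le> exp y\<close>, the factor \<open>1 - y + y^2\<close> is then at least
    \<open>exp (- y)\<close>.\<close>
  have "1 \<le> (1 + y) * (1 - y + y\<^sup>2)"
    using y by (simp add: algebra_simps power2_eq_square)
  also have "\<dots> \<le> exp y * (1 - y + y\<^sup>2)"
    using y by (intro mult_right_mono exp_ge_add_one_self) auto
  finally have "exp (- y) \<le> 1 - y + y\<^sup>2"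
    by (simp add: exp_minus field_simps)
  then show ?thesis by (simp add: y_def)
qed

text \<open>Apply \<open>1 + z \<le> exp z\<close> with \<open>z = p * (exp l - 1)\<close>, then the
  quadratic bound for \<open>exp l\<close>. For \<open>l\<close> in \<open>[-1, 1]\<close> the
  exponent is proportional to \<open>p\<close>, not to a constant as in Hoeffding's lemma, so sparse
  graphs get bounds on the right scale.\<close>

lemma bernoulli_centred_mgf_le:
  fixes p l :: real
  assumes "0 \<le> p" "p \<le> 1" "\<bar>l\<bar> \<le> 1"
  shows "measure_pmf.expectation (bernoulli_pmf p) (\<lambda>b. exp (l * (of_bool b - p))) \<le> exp (l\<^sup>2 * p)"
proof -
  have "measure_pmf.expectation (bernoulli_pmf p) (\<lambda>b. exp (l * (of_bool b - p)))
      = exp (l * (1 - p)) * p + exp (- (l * p)) * (1 - p)"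
    using assms by simp
  also have "\<dots> = exp (- (l * p)) * (1 + p * (exp l - 1))"
  proof -
    have "exp (l * (1 - p)) = exp (- (l * p)) * exp l"
      by (simp add: algebra_simps flip: exp_add)
    then show ?thesis by (simp only:) (simp only: algebra_simps)
  qed
  also have "\<dots> \<le> exp (- (l * p)) * exp (p * (exp l - 1))"
    by (intro mult_left_mono exp_ge_add_one_self) auto
  also have "\<dots> = exp (p * (exp l - 1 - l))"
    by (simp add: algebra_simps flip: exp_add)
  also have "\<dots> \<le> exp (p * l\<^sup>2)"
    using exp_le_quadratic[OF assms(3)] assms by (simp add: mult_left_mono)
  finally show ?thesis by (simp add: mult.commute)
qed

lemma Pi_bernoulli_centred_mgf:
  fixes p :: "'a \<Rightarrow> real"
  assumes "finite E" "F \<subseteq> E" "\<And>e. e \<in> E \<Longrightarrow> 0 \<le> p e \<and> p e \<le> 1" "\<bar>l\<bar> \<le> 1"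
    and "(\<Sum>e\<in>F. p e) \<le> v"
  defines "M \<equiv> measure_pmf (Pi_pmf E False (\<lambda>e. bernoulli_pmf (p e)))"
  shows "integrable M (\<lambda>g. exp (l * (\<Sum>e\<in>F. of_bool (g e) - p e)))" (is ?A)
    and "(\<integral>g. exp (l * (\<Sum>e\<in>F. of_bool (g e) - p e)) \<partial>M) \<le> exp (l\<^sup>2 * v)" (is ?B)
proof -
  \<comment> \<open>The factor is 1 off \<open>F\<close>, so the exponential of a sum over
    \<open>F\<close> becomes a product over all coordinates and its expectation factorises.\<close>
  define f :: "'a \<Rightarrow> bool \<Rightarrow> real"
    where "f = (\<lambda>e b. if e \<in> F then exp (l * (of_bool b - p e)) else 1)"
  have finF: "finite F" using assms finite_subset by blast
  have EF: "E \<inter> F = F" using assms by blast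
  have prod_F: "(\<Prod>e\<in>E. if e \<in> F then h e else (1 :: real)) = (\<Prod>e\<in>F. h e)" for h
    using prod.inter_restrict[OF assms(1), of h F] EF by simp
  have prod: "exp (l * (\<Sum>e\<in>F. of_bool (g e) - p e)) = (\<Prod>e\<in>E. f e (g e))" for g
    unfolding f_def prod_F using finF by (simp add: sum_distrib_left exp_sum)
  have int: "integrable (measure_pmf (bernoulli_pmf (p e))) (f e)" for e
    by (intro integrable_measure_pmf_finite) (simp add: finite_subset[OF subset_UNIV])
  show ?A
    unfolding prod M_def by (intro integrable_prod_Pi_pmf assms int)
  have "(\<integral>g. exp (l * (\<Sum>e\<in>F. of_bool (g e) - p e)) \<partial>M)
      = (\<Prod>e\<in>E. measure_pmf.expectation (bernoulli_pmf (p e)) (f e))"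
    unfolding prod M_def by (intro expectation_prod_Pi_pmf assms int) (auto simp: f_def)
  also have "\<dots> = (\<Prod>e\<in>E. if e \<in> F then
        measure_pmf.expectation (bernoulli_pmf (p e)) (\<lambda>b. exp (l * (of_bool b - p e))) else 1)"
    by (intro prod.cong) (auto simp: f_def)
  also have "\<dots> = (\<Prod>e\<in>F.
        measure_pmf.expectation (bernoulli_pmf (p e)) (\<lambda>b. exp (l * (of_bool b - p e))))"
    by (rule prod_F)
  also have "\<dots> \<le> (\<Prod>e\<in>F. exp (l\<^sup>2 * p e))"
  proof (intro prod_mono conjI)
    fix e assume "e \<in> F"
    with assms have "0 \<le> p e" "p e \<le> 1" by auto
    then show "measure_pmf.expectation (bernoulli_pmf (p e)) (\<lambda>b. exp (l * (of_bool b - p e)))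
        \<le> exp (l\<^sup>2 * p e)"
      using assms by (intro bernoulli_centred_mgf_le) auto
  qed (auto intro: Bochner_Integration.integral_nonneg)
  also have "\<dots> = exp (l\<^sup>2 * (\<Sum>e\<in>F. p e))"
    using finF by (simp add: sum_distrib_left exp_sum)
  also have "\<dots> \<le> exp (l\<^sup>2 * v)"
    using assms by (simp add: mult_left_mono)
  finally show ?B .
qed

text \<open>Chernoff with the tilt \<open>h = 3 sqrt (L / v)\<close>: for
  \<open>u = 5 sqrt (v L)\<close> the exponent is \<open>h^2 v - h u = 9 L - 15 L = - 6 L\<close>.
  The condition \<open>9 L \<le> v\<close> says exactly that \<open>h \<le> 1\<close>. With
  \<open>L = ln n\<close>, the rate 6 later pays for a union bound over order \<open>n^4\<close>
  pairs.\<close>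

lemma Pi_bernoulli_deviation:
  fixes p :: "'a \<Rightarrow> real"
  assumes "finite E" "F \<subseteq> E" "\<And>e. e \<in> E \<Longrightarrow> 0 \<le> p e \<and> p e \<le> 1"
    and "(\<Sum>e\<in>F. p e) \<le> v" "0 < L" "9 * L \<le> v"
  shows "measure_pmf.prob (Pi_pmf E False (\<lambda>e. bernoulli_pmf (p e)))
      {g. \<bar>\<Sum>e\<in>F. of_bool (g e) - p e\<bar> \<ge> 5 * sqrt (v * L)} \<le> 2 * exp (- 6 * L)"
proof -
  define M where "M = Pi_pmf E False (\<lambda>e. bernoulli_pmf (p e))"
  define h where "h = 3 * sqrt (L / v)"
  define u where "u = 5 * sqrt (v * L)"
  define S where "S = (\<lambda>g. \<Sum>e\<in>F. of_bool (g e) - p e)"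
  have v: "v > 0" using assms by linarith
  have "L / v \<le> 1 / 9" using assms v by (simp add: field_simps)
  then have "sqrt (L / v) \<le> sqrt (1 / 9)" by (rule real_sqrt_le_mono)
  also have "sqrt (1 / 9) = (1 / 3 :: real)" by (rule real_sqrt_unique) (auto simp: power2_eq_square)
  finally have h: "0 < h" "h \<le> 1" using assms v by (auto simp: h_def)
  have h2: "h\<^sup>2 * v = 9 * L" using assms v by (simp add: h_def power_mult_distrib)
  have "sqrt (L / v) * sqrt (v * L) = sqrt (L * L)"
    using v by (simp flip: real_sqrt_mult)
  then have hu: "h * u = 15 * L" using assms by (simp add: h_def u_def)
  \<comment> \<open>The sign \<open>s\<close> covers both tails at once; the bound on the generating
    function only involves \<open>(h s)^2 = h^2\<close>.\<close>
  have tail: "measure_pmf.prob M {g. s * S g \<ge> u} \<le> exp (- 6 * L)" if "\<bar>s\<bar> = 1" for s :: real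
  proof -
    have s2: "s\<^sup>2 = 1" using that by (simp add: abs_square_eq_1)
    have mgf: "integrable M (\<lambda>g. exp (h * s * S g))" "(\<integral>g. exp (h * s * S g) \<partial>M) \<le> exp ((h * s)\<^sup>2 * v)"
      unfolding M_def S_def by (rule Pi_bernoulli_centred_mgf; use assms that h in \<open>simp add: abs_mult\<close>)+
    have "measure_pmf.prob M {g \<in> UNIV. s * S g \<ge> u}
        \<le> exp (- h * u) * (\<integral>g\<in>UNIV. exp (h * (s * S g)) \<partial>M)"
      using h mgf by (intro measure_pmf.Chernoff_ineq_ge) (auto simp: set_integrable_def mult.assoc)
    also have "\<dots> \<le> exp (- h * u) * exp ((h * s)\<^sup>2 * v)"
      using mgf by (intro mult_left_mono) (auto simp: set_lebesgue_integral_def mult.assoc)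
    also have "\<dots> = exp (- 6 * L)"
      using h2 hu s2 by (simp add: power_mult_distrib flip: exp_add)
    finally show ?thesis by simp
  qed
  have "{g. \<bar>S g\<bar> \<ge> u} \<subseteq> {g. 1 * S g \<ge> u} \<union> {g. - 1 * S g \<ge> u}" by auto
  then have "measure_pmf.prob M {g. \<bar>S g\<bar> \<ge> u}
      \<le> measure_pmf.prob M ({g. 1 * S g \<ge> u} \<union> {g. - 1 * S g \<ge> u})"
    by (intro measure_pmf.finite_measure_mono) auto
  also have "\<dots> \<le> measure_pmf.prob M {g. 1 * S g \<ge> u} + measure_pmf.prob M {g. - 1 * S g \<ge> u}"
    by (intro measure_Un_le) auto
  also have "\<dots> \<le> 2 * exp (- 6 * L)" using tail[of 1] tail[of "- 1"] by simp
  finally show ?thesis by (simp add: M_def S_def u_def)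
qed

text \<open>By independence, the coordinates in \<open>E1\<close> can be frozen at \<open>f\<close>
  while the others keep their law; a bound uniform in \<open>f\<close> survives averaging over
  \<open>f\<close>.\<close>

lemma Pi_pmf_conditional_bound:
  assumes "finite E" "E1 \<subseteq> E"
    and "\<And>f. measure_pmf.prob (Pi_pmf (E - E1) d p) {g. Q (\<lambda>x. if x \<in> E1 then f x else g x)} \<le> b"
  shows "measure_pmf.prob (Pi_pmf E d p) {g. Q g} \<le> b"
proof -
  define m where "m = (\<lambda>f g x. if x \<in> E1 then f x else g x :: 'b)"
  have "Pi_pmf E d p = Pi_pmf (E1 \<union> (E - E1)) d p"
    using assms by (simp add: Un_absorb1)
  also have "\<dots> = map_pmf (\<lambda>(f, g). m f g) (pair_pmf (Pi_pmf E1 d p) (Pi_pmf (E - E1) d p))"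
    unfolding m_def using assms by (intro Pi_pmf_union) (auto intro: finite_subset)
  also have "\<dots> = Pi_pmf E1 d p \<bind> (\<lambda>f. map_pmf (m f) (Pi_pmf (E - E1) d p))"
    by (simp add: pair_pmf_def map_bind_pmf map_pmf_def bind_assoc_pmf bind_return_pmf)
  finally have eq: "Pi_pmf E d p = Pi_pmf E1 d p \<bind> (\<lambda>f. map_pmf (m f) (Pi_pmf (E - E1) d p))" .
  have "measure_pmf.prob (Pi_pmf E d p) {g. Q g}
     = measure_pmf.expectation (Pi_pmf E1 d p)
         (\<lambda>f. measure_pmf.prob (Pi_pmf (E - E1) d p) {g. Q (m f g)})"
    unfolding eq measure_pmf_bind
    by (subst measure_pmf.measure_bind[where N = "count_space UNIV"])
      (auto simp: vimage_def intro: measure_pmf_in_subprob_space)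
  also have "\<dots> \<le> measure_pmf.expectation (Pi_pmf E1 d p) (\<lambda>f. b)"
  proof (intro integral_mono)
    show "integrable (Pi_pmf E1 d p) (\<lambda>f. measure_pmf.prob (Pi_pmf (E - E1) d p) {g. Q (m f g)})"
      by (rule measure_pmf.integrable_const_bound[where B = 1]) auto
  qed (use assms(3) in \<open>auto simp: m_def\<close>)
  also have "\<dots> = b" by simp
  finally show ?thesis .
qed

section \<open>Relative entropy and the bilinear form\<close>

text \<open>Using \<open>ln z \<le> z - 1\<close> in both terms leaves the chi-squared divergence on
  the right.\<close>

lemma bernoulli_KL_le:
  assumes "0 \<le> p" "p \<le> 1" "0 < q" "q < 1"
  shows "bernoulli_KL p q \<le> (p - q)\<^sup>2 / (q * (1 - q))"
proof -
  have *: "x * ln (x / y) \<le> x * (x / y - 1)" if "0 \<le> x" "0 < y" for x y :: real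
    using that by (cases "x = 0") (auto intro!: mult_left_mono ln_le_minus_one)
  have "bernoulli_KL p q \<le> p * (p / q - 1) + (1 - p) * ((1 - p) / (1 - q) - 1)"
    unfolding bernoulli_KL_def using assms by (intro add_mono *) auto
  also have "\<dots> = (p - q)\<^sup>2 / (q * (1 - q))"
    using assms by (simp add: field_simps power2_eq_square)
  finally show ?thesis .
qed

text \<open>The relative entropy dominates the squared Hellinger distance,
  since \<open>ln (p / q) = - 2 ln (sqrt (q / p))\<close>.\<close>

lemma bernoulli_KL_ge:
  assumes "0 \<le> p" "p \<le> 1" "0 < q" "q < 1" "p \<le> M" "q \<le> M"
  shows "(p - q)\<^sup>2 / (4 * M) \<le> bernoulli_KL p q"
proof -
  \<comment> \<open>The linear term \<open>x - y\<close> is retained because it cancels when the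
    inequalities for \<open>p, q\<close> and for \<open>1 - p, 1 - q\<close> are added.\<close>
  have *: "(sqrt x - sqrt y)\<^sup>2 + x - y \<le> x * ln (x / y)" if "0 \<le> x" "0 < y" for x y :: real
  proof (cases "x = 0")
    case False
    with that have x: "x > 0" by simp
    have "ln (sqrt (y / x)) \<le> sqrt (y / x) - 1"
      using x that by (intro ln_le_minus_one) auto
    moreover have "ln (sqrt (y / x)) = - ln (x / y) / 2"
      using x that by (simp add: ln_sqrt ln_div)
    ultimately have "ln (x / y) \<ge> 2 - 2 * sqrt (y / x)" by simp
    then have "x * ln (x / y) \<ge> x * (2 - 2 * sqrt (y / x))"
      using x by (intro mult_left_mono) auto
    also have "x * (2 - 2 * sqrt (y / x)) = 2 * x - 2 * (sqrt x * sqrt y)"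
      using x by (simp add: real_sqrt_divide field_simps)
    also have "\<dots> = (sqrt x - sqrt y)\<^sup>2 + x - y"
      using x that by (simp add: power2_diff)
    finally show ?thesis .
  qed (use that in simp)
  have M: "M > 0" using assms by linarith
  \<comment> \<open>This factorisation bounds the Hellinger term from below by
    \<open>(p - q)^2 / (4 M)\<close>; for small \<open>M\<close> it is stronger than Pinsker's
    inequality.\<close>
  have "p - q = (sqrt p - sqrt q) * (sqrt p + sqrt q)"
    using assms by (simp add: algebra_simps)
  then have "(p - q)\<^sup>2 = (sqrt p - sqrt q)\<^sup>2 * (sqrt p + sqrt q)\<^sup>2"
    by (simp add: power_mult_distrib)
  moreover have "sqrt p + sqrt q \<le> 2 * sqrt M"
    using real_sqrt_le_mono[OF assms(5)] real_sqrt_le_mono[OF assms(6)] by linarith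
  then have "(sqrt p - sqrt q)\<^sup>2 * (sqrt p + sqrt q)\<^sup>2 \<le> (sqrt p - sqrt q)\<^sup>2 * (2 * sqrt M)\<^sup>2"
    using assms by (intro mult_left_mono power_mono) auto
  moreover have "(2 * sqrt M)\<^sup>2 = 4 * M" using M by (simp add: power_mult_distrib)
  ultimately have "(p - q)\<^sup>2 / (4 * M) \<le> (sqrt p - sqrt q)\<^sup>2"
    using M by (simp add: field_simps)
  moreover have "(sqrt p - sqrt q)\<^sup>2 + p - q \<le> p * ln (p / q)"
    using assms by (intro *) auto
  moreover have "(sqrt (1 - p) - sqrt (1 - q))\<^sup>2 + (1 - p) - (1 - q)
      \<le> (1 - p) * ln ((1 - p) / (1 - q))"
    using assms by (intro *) auto
  moreover have "0 \<le> (sqrt (1 - p) - sqrt (1 - q))\<^sup>2" by simp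
  ultimately show ?thesis unfolding bernoulli_KL_def by linarith
qed

text \<open>The pooled value \<open>q\<close> is a weighted mean of the three estimators, hence
  within \<open>\<epsilon>\<close> of \<open>\<tau>\<close> and within \<open>2 \<epsilon>\<close>
  of each of them. Three chi-squared bounds with numerator \<open>4 \<epsilon>^2\<close> give the
  factor 12; \<open>lo\<close> and \<open>hi\<close> keep \<open>q\<close> away from 0 and
  1.\<close>

lemma KL_sum_same_le:
  fixes N1 N2 N3 p1 p2 p3 q \<epsilon> \<tau> lo hi Nb :: real
  assumes N: "0 < N1" "0 < N2" "0 < N3" "N1 \<le> Nb" "N2 \<le> Nb" "N3 \<le> Nb"
    and p: "0 \<le> p1" "p1 \<le> 1" "0 \<le> p2" "p2 \<le> 1" "0 \<le> p3" "p3 \<le> 1"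
    and dev: "\<bar>p1 - \<tau>\<bar> \<le> \<epsilon>" "\<bar>p2 - \<tau>\<bar> \<le> \<epsilon>" "\<bar>p3 - \<tau>\<bar> \<le> \<epsilon>"
    and \<tau>: "lo + \<epsilon> \<le> \<tau>" "\<tau> + \<epsilon> + hi \<le> 1" "0 < lo" "0 < hi"
    and q: "q = (N1 * p1 + 2 * (N3 * p3) + N2 * p2) / (N1 + 2 * N3 + N2)"
  shows "N1 * bernoulli_KL p1 q + N2 * bernoulli_KL p2 q + N3 * bernoulli_KL p3 q
    \<le> 12 * Nb * \<epsilon>\<^sup>2 / (lo * hi)"
proof -
  define w where "w = N1 + 2 * N3 + N2"
  have w: "w > 0" using N by (simp add: w_def)
  have upper: "N1 * p1 + 2 * (N3 * p3) + N2 * p2 \<le> (\<tau> + \<epsilon>) * w"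
  proof -
    have "N1 * p1 \<le> N1 * (\<tau> + \<epsilon>)" "N3 * p3 \<le> N3 * (\<tau> + \<epsilon>)" "N2 * p2 \<le> N2 * (\<tau> + \<epsilon>)"
      using N dev by (auto intro!: mult_left_mono)
    then show ?thesis by (simp add: w_def algebra_simps)
  qed
  have lower: "(\<tau> - \<epsilon>) * w \<le> N1 * p1 + 2 * (N3 * p3) + N2 * p2"
  proof -
    have "N1 * (\<tau> - \<epsilon>) \<le> N1 * p1" "N3 * (\<tau> - \<epsilon>) \<le> N3 * p3" "N2 * (\<tau> - \<epsilon>) \<le> N2 * p2"
      using N dev by (auto intro!: mult_left_mono)
    then show ?thesis by (simp add: w_def algebra_simps)
  qed
  have q1: "q \<le> \<tau> + \<epsilon>" "\<tau> - \<epsilon> \<le> q"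
    using upper lower w unfolding q w_def[symmetric] by (simp_all add: field_simps)
  have q2: "lo \<le> q" "hi \<le> 1 - q" "q < 1" "0 < q" using q1 \<tau> by linarith+
  have e: "\<epsilon> \<ge> 0" using dev by linarith
  have *: "M * bernoulli_KL p q \<le> Nb * ((2 * \<epsilon>)\<^sup>2 / (lo * hi))"
    if "0 < M" "M \<le> Nb" "0 \<le> p" "p \<le> 1" "\<bar>p - \<tau>\<bar> \<le> \<epsilon>" for M p
  proof -
    have "bernoulli_KL p q \<le> (p - q)\<^sup>2 / (q * (1 - q))"
      using that q2 by (intro bernoulli_KL_le) auto
    also have "\<dots> \<le> (2 * \<epsilon>)\<^sup>2 / (lo * hi)"
    proof (intro frac_le mult_mono)
      have "\<bar>p - q\<bar> \<le> \<bar>2 * \<epsilon>\<bar>" using that(5) q1 by linarith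
      then show "(p - q)\<^sup>2 \<le> (2 * \<epsilon>)\<^sup>2" by (simp only: abs_le_square_iff)
    qed (use q2 \<tau> in auto)
    finally have "M * bernoulli_KL p q \<le> M * ((2 * \<epsilon>)\<^sup>2 / (lo * hi))"
      using that by (intro mult_left_mono) auto
    also have "\<dots> \<le> Nb * ((2 * \<epsilon>)\<^sup>2 / (lo * hi))"
      using that \<tau> by (intro mult_right_mono) auto
    finally show ?thesis .
  qed
  have "N1 * bernoulli_KL p1 q + N2 * bernoulli_KL p2 q + N3 * bernoulli_KL p3 q
      \<le> Nb * ((2 * \<epsilon>)\<^sup>2 / (lo * hi)) + Nb * ((2 * \<epsilon>)\<^sup>2 / (lo * hi)) + Nb * ((2 * \<epsilon>)\<^sup>2 / (lo * hi))"
    using N p dev by (intro add_mono *) auto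
  also have "\<dots> = 12 * Nb * \<epsilon>\<^sup>2 / (lo * hi)" by (simp add: power_mult_distrib mult_ac)
  finally show ?thesis .
qed

text \<open>The combination \<open>p1 + p2 - 2 p3\<close> is unchanged when \<open>q\<close> is
  subtracted from each term, so the pooled value drops out. The constant 24 is 4 from
  \<open>bernoulli_KL_ge\<close> times the squared length 6 of \<open>(1, 1, -2)\<close>.\<close>

lemma KL_sum_ge:
  fixes N1 N2 N3 p1 p2 p3 q Na M :: real
  assumes N: "0 \<le> Na" "Na \<le> N1" "Na \<le> N2" "Na \<le> N3"
    and p: "0 \<le> p1" "p1 \<le> 1" "0 \<le> p2" "p2 \<le> 1" "0 \<le> p3" "p3 \<le> 1"
    and M: "p1 \<le> M" "p2 \<le> M" "p3 \<le> M" "q \<le> M" "0 < q" "q < 1"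
  shows "Na * (p1 + p2 - 2 * p3)\<^sup>2 / (24 * M)
    \<le> N1 * bernoulli_KL p1 q + N2 * bernoulli_KL p2 q + N3 * bernoulli_KL p3 q"
proof -
  have M0: "M > 0" using M by linarith
  have *: "Na * ((p - q)\<^sup>2 / (4 * M)) \<le> N * bernoulli_KL p q"
    if "Na \<le> N" "0 \<le> p" "p \<le> 1" "p \<le> M" for N p
  proof -
    have "(p - q)\<^sup>2 / (4 * M) \<le> bernoulli_KL p q"
      using that M by (intro bernoulli_KL_ge) auto
    then show ?thesis
      using that N M0 by (intro mult_mono) auto
  qed
  define a b c where "a = p1 - q" and "b = p2 - q" and "c = p3 - q"
  \<comment> \<open>Lagrange's identity for the Cauchy-Schwarz inequality between
    \<open>(a, b, c)\<close> and \<open>(1, 1, -2)\<close>.\<close>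
  have "6 * (a\<^sup>2 + b\<^sup>2 + c\<^sup>2) - (a + b - 2 * c)\<^sup>2 = (2 * a + c)\<^sup>2 + (2 * b + c)\<^sup>2 + (a - b)\<^sup>2"
    by (simp add: power2_eq_square algebra_simps)
  then have "(a + b - 2 * c)\<^sup>2 \<le> 6 * (a\<^sup>2 + b\<^sup>2 + c\<^sup>2)"
    by (smt (verit) zero_le_power2)
  then have "Na * (a + b - 2 * c)\<^sup>2 / (24 * M) \<le> Na * (6 * (a\<^sup>2 + b\<^sup>2 + c\<^sup>2)) / (24 * M)"
    using M0 N by (intro divide_right_mono mult_left_mono) auto
  also have "\<dots> = Na * (a\<^sup>2 / (4 * M)) + Na * (b\<^sup>2 / (4 * M)) + Na * (c\<^sup>2 / (4 * M))"
    using M0 by (simp add: field_simps)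
  also have "\<dots> \<le> N1 * bernoulli_KL p1 q + N2 * bernoulli_KL p2 q + N3 * bernoulli_KL p3 q"
    unfolding a_def b_def c_def using assms by (intro add_mono *) auto
  finally show ?thesis by (simp add: a_def b_def c_def algebra_simps)
qed

section \<open>The bilinear form of block densities and stability of ratios\<close>

definition block_form :: "real \<Rightarrow> real \<Rightarrow> real \<Rightarrow> real \<Rightarrow> real \<Rightarrow> real" where
  "block_form \<theta>1 \<theta>2 \<rho> x y =
     x * y * \<theta>1 + (x * (1 - y) + (1 - x) * y) * \<rho> + (1 - x) * (1 - y) * \<theta>2"

text \<open>Move one argument at a time. The form is affine in each argument, and its slope is a
  difference of two averages of edge probabilities, both in \<open>[0, t]\<close>. The slopes are
  taken at \<open>y\<close> and at \<open>x'\<close>, the two points assumed to lie in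
  \<open>[0, 1]\<close>.\<close>

lemma block_form_diff_le:
  assumes "0 \<le> \<rho>" "\<rho> \<le> t" "0 \<le> \<theta>1" "\<theta>1 \<le> t" "0 \<le> \<theta>2" "\<theta>2 \<le> t"
    and "0 \<le> y" "y \<le> 1" "0 \<le> x'" "x' \<le> 1"
  shows "\<bar>block_form \<theta>1 \<theta>2 \<rho> x y - block_form \<theta>1 \<theta>2 \<rho> x' y'\<bar> \<le> t * (\<bar>x - x'\<bar> + \<bar>y - y'\<bar>)"
proof -
  have slope: "\<bar>z * \<theta>1 + (1 - z) * \<rho> - (z * \<rho> + (1 - z) * \<theta>2)\<bar> \<le> t" if "0 \<le> z" "z \<le> 1" for z
  proof -
    have "z * \<theta>1 + (1 - z) * \<rho> \<le> z * t + (1 - z) * t" "z * \<rho> + (1 - z) * \<theta>2 \<le> z * t + (1 - z) * t"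
      using that assms by (auto intro!: add_mono mult_left_mono)
    moreover have "0 \<le> z * \<theta>1 + (1 - z) * \<rho>" "0 \<le> z * \<rho> + (1 - z) * \<theta>2"
      using that assms by auto
    ultimately show ?thesis by (simp add: abs_le_iff algebra_simps)
  qed
  have "block_form \<theta>1 \<theta>2 \<rho> x y - block_form \<theta>1 \<theta>2 \<rho> x' y'
     = (x - x') * (y * \<theta>1 + (1 - y) * \<rho> - (y * \<rho> + (1 - y) * \<theta>2))
       + (y - y') * (x' * \<theta>1 + (1 - x') * \<rho> - (x' * \<rho> + (1 - x') * \<theta>2))"
    by (simp add: block_form_def algebra_simps)
  also have "\<bar>\<dots>\<bar> \<le> \<bar>x - x'\<bar> * t + \<bar>y - y'\<bar> * t"
    using slope[of y] slope[of x'] assms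
    by (intro order.trans[OF abs_triangle_ineq] add_mono) (auto simp: abs_mult intro!: mult_left_mono)
  finally show ?thesis by (simp add: algebra_simps)
qed

lemma block_form_second_difference:
  "block_form \<theta>1 \<theta>2 \<rho> x x + block_form \<theta>1 \<theta>2 \<rho> y y - 2 * block_form \<theta>1 \<theta>2 \<rho> x y
     = (x - y)\<^sup>2 * (\<theta>1 + \<theta>2 - 2 * \<rho>)"
  by (simp add: block_form_def power2_eq_square algebra_simps)

lemma block_form_le:
  assumes "0 \<le> x" "x \<le> 1" "0 \<le> y" "y \<le> 1" "\<theta>1 \<le> t" "\<theta>2 \<le> t" "\<rho> \<le> t"
  shows "block_form \<theta>1 \<theta>2 \<rho> x y \<le> t"
proof -
  have "block_form \<theta>1 \<theta>2 \<rho> x y \<le> x * y * t + (x * (1 - y) + (1 - x) * y) * t + (1 - x) * (1 - y) * t"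
    unfolding block_form_def using assms by (intro add_mono mult_left_mono) auto
  also have "\<dots> = t" by (simp add: algebra_simps)
  finally show ?thesis .
qed

text \<open>The probability \<open>x^2 + (1 - x)^2\<close> that two draws fall in the same block is
  at least 1/2. On the diagonal this keeps the estimators away from 0 even when
  \<open>\<rho> = 0\<close>.\<close>

lemma block_form_diag_ge:
  assumes "0 \<le> x" "x \<le> 1" "s \<le> \<theta>1" "s \<le> \<theta>2" "0 \<le> \<rho>" "0 \<le> s"
  shows "s / 2 \<le> block_form \<theta>1 \<theta>2 \<rho> x x"
proof -
  have "0 \<le> (2 * x - 1)\<^sup>2 * s" using assms by simp
  then have "s / 2 \<le> x * x * s + (1 - x) * (1 - x) * s" by (simp add: power2_eq_square algebra_simps)
  also have "\<dots> \<le> x * x * \<theta>1 + (1 - x) * (1 - x) * \<theta>2"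
    using assms by (intro add_mono mult_left_mono) auto
  also have "\<dots> \<le> block_form \<theta>1 \<theta>2 \<rho> x x"
    unfolding block_form_def using assms by simp
  finally show ?thesis .
qed

text \<open>The numerator of the difference is \<open>y (x - a) + x (b - y)\<close>, at most
  \<open>(x + y) d\<close>. The random total \<open>x + y\<close> cancels, so only
  \<open>a + b\<close> has to be bounded below.\<close>

lemma fraction_deviation_le:
  fixes x y a b d m :: real
  assumes "0 \<le> x" "0 \<le> y" "0 < x + y" "0 < m" "m \<le> a + b" "\<bar>x - a\<bar> \<le> d" "\<bar>y - b\<bar> \<le> d"
  shows "\<bar>x / (x + y) - a / (a + b)\<bar> \<le> d / m"
proof -
  have ab: "a + b > 0" using assms by linarith
  have "x / (x + y) - a / (a + b) = (x * b - a * y) / ((x + y) * (a + b))"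
    using assms ab by (simp add: field_simps)
  also have "x * b - a * y = y * (x - a) + x * (b - y)" by (simp add: algebra_simps)
  finally have "\<bar>x / (x + y) - a / (a + b)\<bar> = \<bar>y * (x - a) + x * (b - y)\<bar> / ((x + y) * (a + b))"
    using assms ab by simp
  also have "\<dots> \<le> ((x + y) * d) / ((x + y) * (a + b))"
  proof (intro divide_right_mono)
    have "\<bar>y * (x - a) + x * (b - y)\<bar> \<le> y * \<bar>x - a\<bar> + x * \<bar>b - y\<bar>"
      using assms by (intro order.trans[OF abs_triangle_ineq]) (simp add: abs_mult)
    also have "\<dots> \<le> y * d + x * d"
      using assms by (intro add_mono mult_left_mono) auto
    finally show "\<bar>y * (x - a) + x * (b - y)\<bar> \<le> (x + y) * d" by (simp add: algebra_simps)
  qed (use assms ab in auto)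
  also have "\<dots> = d / (a + b)" using assms by simp
  also have "\<dots> \<le> d / m"
    using assms by (intro frac_le) auto
  finally show ?thesis .
qed

text \<open>Here \<open>o'\<close> plays the role of the indicator of \<open>i = j\<close> in \<^const>\<open>awcd_N\<close>.\<close>

lemma ratio_deviation_le:
  fixes S Q D D' u t m w o' :: real
  assumes "\<bar>S - Q\<bar> \<le> u" "0 \<le> Q" "Q \<le> t * (D * D')" "o' = 0 \<or> o' = 1"
    and "0 < m" "m \<le> D * (D' - o')" "0 < D" "1 < D'" "t * D \<le> w" "0 \<le> t"
  shows "\<bar>S / (D * (D' - o')) - Q / (D * D')\<bar> \<le> (u + w) / m"
proof -
  have pos: "0 < D * (D' - o')" using assms by linarith
  have D': "0 < D'" "0 < D' - o'" using assms by auto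
  \<comment> \<open>The first summand is the error of the numerator; the second is the effect of
    replacing \<open>D'\<close> by \<open>D' - o'\<close> in the denominator.\<close>
  have "S / (D * (D' - o')) - Q / (D * D') = (S - Q) / (D * (D' - o')) + Q / (D * D') * (o' * D) / (D * (D' - o'))"
  proof -
    obtain E where E: "D' = E + o'" by (metis add_diff_cancel_left' diff_add_cancel)
    then have "E > 0" "E + o' > 0" using D' by auto
    then show ?thesis unfolding E using assms(7) by (simp add: divide_simps) (simp add: algebra_simps)
  qed
  also have "\<bar>\<dots>\<bar> \<le> u / (D * (D' - o')) + w / (D * (D' - o'))"
  proof (intro order.trans[OF abs_triangle_ineq] add_mono)
    show "\<bar>(S - Q) / (D * (D' - o'))\<bar> \<le> u / (D * (D' - o'))"
      unfolding abs_divide abs_of_pos[OF pos] using assms(1) pos by (intro divide_right_mono) auto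
    have "Q / (D * D') \<le> t" using assms D' by (simp add: field_simps)
    moreover have "o' * D \<le> D" "0 \<le> o' * D" using assms by auto
    moreover have "0 \<le> Q / (D * D')" using assms D' by simp
    ultimately have "Q / (D * D') * (o' * D) \<le> t * D" "0 \<le> Q / (D * D') * (o' * D)"
      using assms(10) by (blast intro: mult_mono mult_nonneg_nonneg)+
    then show "\<bar>Q / (D * D') * (o' * D) / (D * (D' - o'))\<bar> \<le> w / (D * (D' - o'))"
      unfolding abs_divide abs_of_pos[OF pos] using assms(9) pos by (intro divide_right_mono) auto
  qed
  also have "\<dots> = (u + w) / (D * (D' - o'))" by (simp add: add_divide_distrib)
  also have "\<dots> \<le> (u + w) / m"
  proof -
    have "0 \<le> u" using assms by linarith
    moreover have "0 \<le> t * D" using assms by simp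
    then have "0 \<le> w" using assms by linarith
    ultimately show ?thesis using assms by (intro divide_left_mono) auto
  qed
  finally show ?thesis .
qed

section \<open>Neighbourhood sums in the block model\<close>

locale two_block_model =
  fixes C1 C2 :: "nat set" and \<theta>1 \<theta>2 \<rho> :: real
  assumes finite_blocks: "finite C1" "finite C2" and disjoint_blocks: "C1 \<inter> C2 = {}"
    and probs: "0 \<le> \<rho>" "\<rho> < \<theta>1" "\<rho> < \<theta>2" "\<theta>1 \<le> 1" "\<theta>2 \<le> 1"
begin

abbreviation V :: "nat set" where "V \<equiv> C1 \<union> C2"

abbreviation adj :: "(nat set \<Rightarrow> bool) \<Rightarrow> rmatrix" where "adj g \<equiv> adjacency_matrix V g"

abbreviation nb :: "(nat set \<Rightarrow> bool) \<Rightarrow> nat \<Rightarrow> nat set" where "nb g \<equiv> neighbours V (adj g)"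

abbreviation P :: "nat \<Rightarrow> nat \<Rightarrow> real" where "P a b \<equiv> edge_prob C1 C2 \<theta>1 \<theta>2 \<rho> {a, b}"

section \<open>Adjacency entries and neighbourhoods\<close>

lemma finite_V: "finite V" using finite_blocks by simp

lemma adj_eq: "i \<in> V \<Longrightarrow> j \<in> V \<Longrightarrow> adj g i j = of_bool (i \<noteq> j \<and> g {i, j})"
  by (auto simp: adjacency_matrix_def vertex_pairs_def card_2_iff doubleton_eq_iff)

lemma adj_sym: "adj g i j = adj g j i"
  by (simp add: adjacency_matrix_def insert_commute)

lemma nb_eq: "i \<in> V \<Longrightarrow> nb g i = {j \<in> V. j \<noteq> i \<and> g {i, j}}"
  by (auto simp: neighbours_def adj_eq)

lemma nb_subset: "nb g i \<subseteq> V" by (auto simp: neighbours_def)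

lemma finite_nb: "finite (nb g i)" using nb_subset finite_V finite_subset by blast

lemma adj_eq_nb: "i \<in> V \<Longrightarrow> j \<in> V \<Longrightarrow> adj g i j = of_bool (j \<in> nb g i)"
  by (simp add: adj_eq nb_eq eq_commute)

lemma nb_sym: "i \<in> V \<Longrightarrow> j \<in> V \<Longrightarrow> j \<in> nb g i \<longleftrightarrow> i \<in> nb g j"
  by (auto simp: nb_eq insert_commute)

lemma sum_adj_row: "i \<in> V \<Longrightarrow> (\<Sum>a\<in>nb g j. adj g i a) = card (nb g i \<inter> nb g j)"
proof -
  assume i: "i \<in> V"
  have "adj g i a = of_bool (a \<in> nb g i)" if "a \<in> nb g j" for a
    using adj_eq_nb[OF i] nb_subset that by blast
  then have "(\<Sum>a\<in>nb g j. adj g i a) = (\<Sum>a\<in>nb g j. of_bool (a \<in> nb g i))"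
    by (intro sum.cong) auto
  also have "\<dots> = card (nb g i \<inter> nb g j)"
    using finite_nb by (simp add: of_bool_def Int_commute flip: sum.inter_restrict)
  finally show ?thesis .
qed

text \<open>The correction in \<open>awcd_S\<close> removes the walks \<open>i, a, b, j\<close> with
  \<open>a = j\<close> or \<open>b = i\<close>, which run along the edge \<open>ij\<close> itself.
  What remains involves no edge at \<open>i\<close> or \<open>j\<close>, and this is what permits
  conditioning on the two neighbourhoods.\<close>

lemma awcd_S_eq:
  assumes ij: "i \<in> V" "j \<in> V"
  shows "awcd_S V (adj g) i j = (\<Sum>a\<in>nb g i - {j}. \<Sum>b\<in>nb g j - {i}. adj g a b)"
proof -
  let ?A = "nb g i" and ?B = "nb g j" and ?Y = "adj g"
  have restrict: "(\<Sum>a\<in>V. of_bool (a \<in> A) * h a) = (\<Sum>a\<in>A. h a)" if "A \<subseteq> V" for A and h :: "nat \<Rightarrow> real"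
    using that finite_V by (simp add: of_bool_def if_distrib[of "\<lambda>x. x * _"] Int_absorb1 flip: sum.inter_restrict cong: if_cong)
  have "(\<Sum>a\<in>V. \<Sum>b\<in>V. ?Y i a * ?Y a b * ?Y b j)
      = (\<Sum>a\<in>V. of_bool (a \<in> ?A) * (\<Sum>b\<in>V. of_bool (b \<in> ?B) * ?Y a b))"
    using ij by (auto simp: sum_distrib_left adj_sym[of g _ j] adj_eq_nb mult_ac intro!: sum.cong)
  also have "\<dots> = (\<Sum>a\<in>?A. \<Sum>b\<in>?B. ?Y a b)"
    by (simp add: restrict nb_subset)
  finally have 1: "(\<Sum>a\<in>V. \<Sum>b\<in>V. ?Y i a * ?Y a b * ?Y b j) = (\<Sum>a\<in>?A. \<Sum>b\<in>?B. ?Y a b)" .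
  show ?thesis
  proof (cases "j \<in> ?A")
    case False
    moreover have "i \<notin> ?B" using False ij nb_sym by blast
    moreover have "?Y i j \<noteq> 1" using False ij by (simp add: adj_eq_nb)
    ultimately show ?thesis by (simp add: awcd_S_def 1)
  next
    case True
    then have i: "i \<in> ?B" using ij nb_sym by blast
    have Yij: "?Y i j = 1" using True ij by (simp add: adj_eq_nb)
    have Yji: "?Y j i = 1" using Yij adj_sym by metis
    have row: "(\<Sum>b\<in>?B. ?Y j b) = card ?B" "(\<Sum>a\<in>?A. ?Y a i) = card ?A"
      using ij by (simp_all add: sum_adj_row adj_sym[of g _ i])
    have "(\<Sum>a\<in>?A. \<Sum>b\<in>?B. ?Y a b) = (\<Sum>b\<in>?B. ?Y j b) + (\<Sum>a\<in>?A - {j}. \<Sum>b\<in>?B. ?Y a b)"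
      using True finite_nb by (intro sum.remove) auto
    also have "(\<Sum>a\<in>?A - {j}. \<Sum>b\<in>?B. ?Y a b)
        = (\<Sum>a\<in>?A - {j}. ?Y a i) + (\<Sum>a\<in>?A - {j}. \<Sum>b\<in>?B - {i}. ?Y a b)"
      using i finite_nb by (simp add: sum.remove[of ?B i] sum.distrib)
    \<comment> \<open>One less than the degree of \<open>i\<close>: the walk
      \<open>i, j, i, j\<close> was already counted in the row \<open>a = j\<close>.\<close>
    also have "(\<Sum>a\<in>?A - {j}. ?Y a i) = real (card ?A) - 1"
      using row(2) sum.remove[OF finite_nb True, of "\<lambda>a. ?Y a i"] Yji by simp
    finally have "(\<Sum>a\<in>?A. \<Sum>b\<in>?B. ?Y a b)
        = real (card ?B) + (real (card ?A) - 1) + (\<Sum>a\<in>?A - {j}. \<Sum>b\<in>?B - {i}. ?Y a b)"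
      using row(1) by simp
    then show ?thesis by (simp add: awcd_S_def 1 Yij)
  qed
qed

text \<open>The case \<open>a = b\<close> is included: a singleton gets the within-block parameter
  of its vertex. Sums over products of sets then depend only on block counts, and
  \<open>sum_P_off_diagonal\<close> accounts for the loops.\<close>

lemma P_eq:
  "a \<in> C1 \<Longrightarrow> b \<in> C1 \<Longrightarrow> P a b = \<theta>1" "a \<in> C2 \<Longrightarrow> b \<in> C2 \<Longrightarrow> P a b = \<theta>2"
  "a \<in> C1 \<Longrightarrow> b \<in> C2 \<Longrightarrow> P a b = \<rho>" "a \<in> C2 \<Longrightarrow> b \<in> C1 \<Longrightarrow> P a b = \<rho>"
  using disjoint_blocks by (auto simp: edge_prob_def)

lemma edge_prob_bounds:
  "0 \<le> edge_prob C1 C2 \<theta>1 \<theta>2 \<rho> e" "edge_prob C1 C2 \<theta>1 \<theta>2 \<rho> e \<le> max \<theta>1 \<theta>2"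
  "edge_prob C1 C2 \<theta>1 \<theta>2 \<rho> e \<le> 1"
  using probs by (auto simp: edge_prob_def)

lemma sum_P_row:
  assumes "B \<subseteq> V" "a \<in> V"
  shows "(\<Sum>b\<in>B. P a b) = card (B \<inter> C1) * (if a \<in> C1 then \<theta>1 else \<rho>) + card (B \<inter> C2) * (if a \<in> C1 then \<rho> else \<theta>2)"
proof -
  have "(\<Sum>b\<in>B. P a b) = (\<Sum>b\<in>B \<inter> C1. P a b) + (\<Sum>b\<in>B \<inter> C2. P a b)"
    using assms finite_blocks disjoint_blocks by (subst sum.union_disjoint[symmetric]) (auto intro: sum.cong)
  also have "(\<Sum>b\<in>B \<inter> C1. P a b) = (\<Sum>b\<in>B \<inter> C1. if a \<in> C1 then \<theta>1 else \<rho>)"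
    using assms disjoint_blocks by (intro sum.cong) (auto simp: P_eq)
  also have "(\<Sum>b\<in>B \<inter> C2. P a b) = (\<Sum>b\<in>B \<inter> C2. if a \<in> C1 then \<rho> else \<theta>2)"
    using assms disjoint_blocks by (intro sum.cong) (auto simp: P_eq)
  finally show ?thesis by simp
qed

lemma card_blocks: "B \<subseteq> V \<Longrightarrow> card B = card (B \<inter> C1) + card (B \<inter> C2)"
  using finite_blocks disjoint_blocks
  by (subst card_Un_disjoint[symmetric]) (auto intro: arg_cong[of _ _ card])

lemma sum_P_block:
  assumes "A \<subseteq> V" "B \<subseteq> V"
  shows "(\<Sum>a\<in>A. \<Sum>b\<in>B. P a b)
    = card (A \<inter> C1) * card (B \<inter> C1) * \<theta>1
      + (card (A \<inter> C1) * card (B \<inter> C2) + card (A \<inter> C2) * card (B \<inter> C1)) * \<rho>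
      + card (A \<inter> C2) * card (B \<inter> C2) * \<theta>2"
proof -
  have "(\<Sum>a\<in>A. \<Sum>b\<in>B. P a b) = (\<Sum>a\<in>A \<inter> C1. \<Sum>b\<in>B. P a b) + (\<Sum>a\<in>A \<inter> C2. \<Sum>b\<in>B. P a b)"
    using assms finite_blocks disjoint_blocks by (subst sum.union_disjoint[symmetric]) (auto intro: sum.cong)
  also have "(\<Sum>a\<in>A \<inter> C1. \<Sum>b\<in>B. P a b) = (\<Sum>a\<in>A \<inter> C1. card (B \<inter> C1) * \<theta>1 + card (B \<inter> C2) * \<rho>)"
    using assms by (intro sum.cong) (auto simp: sum_P_row)
  also have "(\<Sum>a\<in>A \<inter> C2. \<Sum>b\<in>B. P a b) = (\<Sum>a\<in>A \<inter> C2. card (B \<inter> C1) * \<rho> + card (B \<inter> C2) * \<theta>2)"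
    using assms disjoint_blocks by (intro sum.cong) (auto simp: sum_P_row)
  finally show ?thesis by (simp add: algebra_simps)
qed

text \<open>The missing terms lie in the row \<open>a = j\<close>, the column \<open>b = i\<close>
  or the diagonal: at most \<open>card B\<close>, \<open>card A\<close> and \<open>card A\<close>
  entries, each at most \<open>t\<close>.\<close>

lemma sum_P_off_diagonal:
  assumes "A \<subseteq> V" "B \<subseteq> V" "\<theta>1 \<le> t" "\<theta>2 \<le> t"
  shows "\<bar>(\<Sum>a\<in>A - {j}. \<Sum>b\<in>B - {i}. of_bool (a \<noteq> b) * P a b) - (\<Sum>a\<in>A. \<Sum>b\<in>B. P a b)\<bar>
    \<le> t * (2 * card A + card B)"
proof -
  have fin: "finite A" "finite B" using assms finite_V finite_subset by blast+
  have t: "0 \<le> t" using probs assms by linarith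
  have P: "0 \<le> P a b" "P a b \<le> t" for a b
    using edge_prob_bounds(1) edge_prob_bounds(2)[of "{a, b}"] assms by auto
  define D where "D = (\<lambda>a b. of_bool (a = j \<or> b = i \<or> a = b) * P a b)"
  have off: "(\<Sum>a\<in>A - {j}. \<Sum>b\<in>B - {i}. of_bool (a \<noteq> b) * P a b)
      = (\<Sum>a\<in>A. \<Sum>b\<in>B. of_bool (a \<noteq> j \<and> b \<noteq> i \<and> a \<noteq> b) * P a b)"
    using fin by (intro sum.mono_neutral_cong_left ballI sum.neutral) (auto intro!: sum.mono_neutral_cong_left)
  have "(\<Sum>a\<in>A. \<Sum>b\<in>B. P a b)
      = (\<Sum>a\<in>A. \<Sum>b\<in>B. of_bool (a \<noteq> j \<and> b \<noteq> i \<and> a \<noteq> b) * P a b) + (\<Sum>a\<in>A. \<Sum>b\<in>B. D a b)"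
    unfolding D_def sum.distrib[symmetric] by (intro sum.cong) auto
  moreover have "0 \<le> (\<Sum>a\<in>A. \<Sum>b\<in>B. D a b)"
    using P by (auto simp: D_def intro!: sum_nonneg)
  moreover have "(\<Sum>a\<in>A. \<Sum>b\<in>B. D a b) \<le> t * (2 * card A + card B)"
  proof -
    have "(\<Sum>a\<in>A. \<Sum>b\<in>B. D a b)
        \<le> (\<Sum>a\<in>A. \<Sum>b\<in>B. t * of_bool (a = j) + t * of_bool (b = i) + t * of_bool (a = b))"
    proof (intro sum_mono)
      fix a b
      have "edge_prob C1 C2 \<theta>1 \<theta>2 \<rho> {a} \<le> t" "edge_prob C1 C2 \<theta>1 \<theta>2 \<rho> {b} \<le> t"
        using P(2)[of a a] P(2)[of b b] by auto
      then show "D a b \<le> t * of_bool (a = j) + t * of_bool (b = i) + t * of_bool (a = b)"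
        using P(2)[of a b] t by (auto simp: D_def)
    qed
    also have "\<dots> = (\<Sum>a\<in>A. t * of_bool (a = j) * card B + t * of_bool (i \<in> B) + t * of_bool (a \<in> B))"
    proof (intro sum.cong refl)
      fix a
      have "(\<Sum>b\<in>B. of_bool (b = i)) = (of_bool (i \<in> B) :: real)"
        "(\<Sum>b\<in>B. of_bool (a = b)) = (of_bool (a \<in> B) :: real)"
        using fin by (simp_all add: of_bool_def sum.delta sum.delta')
      then show "(\<Sum>b\<in>B. t * of_bool (a = j) + t * of_bool (b = i) + t * of_bool (a = b))
          = t * of_bool (a = j) * card B + t * of_bool (i \<in> B) + t * of_bool (a \<in> B)"
        by (simp only: sum.distrib flip: sum_distrib_left) simp
    qed
    also have "\<dots> \<le> (\<Sum>a\<in>A. t * of_bool (a = j) * card B + t + t)"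
      using t by (intro sum_mono) auto
    also have "\<dots> = t * of_bool (j \<in> A) * card B + 2 * t * card A"
    proof -
      have "(\<Sum>a\<in>A. of_bool (a = j)) = (of_bool (j \<in> A) :: real)"
        using fin by (simp add: of_bool_def sum.delta)
      then show ?thesis
        by (simp only: sum.distrib flip: sum_distrib_left sum_distrib_right) simp
    qed
    also have "\<dots> \<le> t * (2 * card A + card B)"
      using t by (simp add: algebra_simps)
    finally show ?thesis .
  qed
  ultimately show ?thesis unfolding off by linarith
qed

end

section \<open>The statistics on the good event\<close>

locale sized_two_block_model = two_block_model +
  fixes n N s t :: real
  assumes n_eq: "n = min (real (card C1)) (real (card C2))"
    and N_eq: "N = max (real (card C1)) (real (card C2))"
    and s_eq: "s = min \<theta>1 \<theta>2" and t_eq: "t = max \<theta>1 \<theta>2"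
    and n_pos: "0 < n"
begin

lemma params:
  "n \<le> card C1" "n \<le> card C2" "card C1 \<le> N" "card C2 \<le> N" "n \<le> N" "0 < N"
  "s \<le> \<theta>1" "s \<le> \<theta>2" "\<theta>1 \<le> t" "\<theta>2 \<le> t" "0 < s" "s \<le> t" "0 < t" "\<rho> < s" "\<rho> < t" "t \<le> 1"
  using n_eq N_eq s_eq t_eq n_pos probs by auto

text \<open>The centring counts \<open>i\<close> as a possible neighbour of itself. This excess of
  at most 1 is absorbed into the deviation in \<open>degree_tail\<close>.\<close>

definition good_degrees :: "(nat set \<Rightarrow> bool) \<Rightarrow> real \<Rightarrow> bool" where
  "good_degrees g d \<longleftrightarrow> (\<forall>i\<in>V.
     \<bar>real (card (nb g i \<inter> C1)) - card C1 * (if i \<in> C1 then \<theta>1 else \<rho>)\<bar> \<le> d \<and>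
     \<bar>real (card (nb g i \<inter> C2)) - card C2 * (if i \<in> C1 then \<rho> else \<theta>2)\<bar> \<le> d)"

text \<open>The conditional mean of \<open>awcd_S\<close> given the edges at \<open>i\<close> or
  \<open>j\<close>. It is still random, through the two neighbourhoods.\<close>

definition S_mean :: "(nat set \<Rightarrow> bool) \<Rightarrow> nat \<Rightarrow> nat \<Rightarrow> real" where
  "S_mean g i j = (\<Sum>a\<in>nb g i - {j}. \<Sum>b\<in>nb g j - {i}. of_bool (a \<noteq> b) * P a b)"

definition good_S :: "(nat set \<Rightarrow> bool) \<Rightarrow> real \<Rightarrow> bool" where
  "good_S g u \<longleftrightarrow> (\<forall>i\<in>V. \<forall>j\<in>V. \<bar>awcd_S V (adj g) i j - S_mean g i j\<bar> \<le> u)"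

text \<open>The limiting fraction of the neighbours of \<open>i\<close> that lie in \<open>C1\<close>.\<close>

definition fraction :: "nat \<Rightarrow> real" where
  "fraction i = (if i \<in> C1 then card C1 * \<theta>1 / (card C1 * \<theta>1 + card C2 * \<rho>)
                 else card C1 * \<rho> / (card C1 * \<rho> + card C2 * \<theta>2))"

lemma fraction_bounds: "0 \<le> fraction i" "fraction i \<le> 1"
proof -
  have "0 \<le> a / (a + b) \<and> a / (a + b) \<le> 1" if "0 \<le> a" "0 \<le> b" for a b :: real
    using that by (auto simp: divide_le_eq_1)
  then show "0 \<le> fraction i" "fraction i \<le> 1"
    using params probs by (auto simp: fraction_def)
qed

text \<open>Over a common denominator the numerator is \<open>n1 n2 (\<theta>1 \<theta>2 - \<rho>^2)
  = n N (s t - \<rho>^2)\<close>, at least \<open>n N t (s - \<rho>)\<close>. The denominator is a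
  product of two expected degrees, each at most \<open>2 N t\<close>.\<close>

lemma fraction_gap:
  assumes "i \<in> C1" "j \<in> C2"
  shows "n * (s - \<rho>) / (4 * N * t) \<le> fraction i - fraction j"
proof -
  define n1 n2 where "n1 = real (card C1)" and "n2 = real (card C2)"
  define a b where "a = n1 * \<theta>1 + n2 * \<rho>" and "b = n1 * \<rho> + n2 * \<theta>2"
  have j: "j \<notin> C1" using assms disjoint_blocks by auto
  have n12: "0 < n1" "0 < n2" "n1 \<le> N" "n2 \<le> N" "n1 * n2 = n * N"
    using params n_pos unfolding n1_def n2_def n_eq N_eq by (auto simp: min_def max_def)
  have st: "\<theta>1 * \<theta>2 = s * t" unfolding s_eq t_eq by (auto simp: min_def max_def)
  have "n1 * \<theta>1 \<le> N * t" "n2 * \<rho> \<le> N * t" "n1 * \<rho> \<le> N * t" "n2 * \<theta>2 \<le> N * t"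
    using params probs n12 by (auto intro!: mult_mono)
  moreover have ab: "0 < a" "0 < b"
    using params probs n12 by (auto simp: a_def b_def add_pos_nonneg add_nonneg_pos)
  ultimately have "a * b \<le> (2 * N * t) * (2 * N * t)"
    using params by (intro mult_mono) (auto simp: a_def b_def)
  moreover have "t * (s - \<rho>) \<le> s * t - \<rho> * \<rho>"
    using params probs by (simp add: algebra_simps mult_left_mono)
  ultimately have "(n * N) * (t * (s - \<rho>)) / ((2 * N * t) * (2 * N * t)) \<le> (n * N) * (s * t - \<rho> * \<rho>) / (a * b)"
  proof (intro frac_le mult_left_mono)
    have "0 \<le> t * (s - \<rho>)" using params by simp
    then have "0 \<le> s * t - \<rho> * \<rho>" using \<open>t * (s - \<rho>) \<le> s * t - \<rho> * \<rho>\<close> by linarith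
    then show "0 \<le> n * N * (s * t - \<rho> * \<rho>)"
      using params n_pos by simp
  qed (use params ab n_pos in auto)
  also have "\<dots> = n1 * \<theta>1 / a - n1 * \<rho> / b"
  proof -
    have "n1 * \<theta>1 / a - n1 * \<rho> / b = (n1 * \<theta>1 * b - n1 * \<rho> * a) / (a * b)"
      using ab by (simp add: diff_frac_eq)
    also have "n1 * \<theta>1 * b - n1 * \<rho> * a = (n1 * n2) * (\<theta>1 * \<theta>2 - \<rho> * \<rho>)"
      by (simp add: a_def b_def algebra_simps)
    finally show ?thesis by (simp add: n12 st)
  qed
  also have "\<dots> = fraction i - fraction j"
    using assms j by (simp add: fraction_def a_def b_def n1_def n2_def)
  also have "(n * N) * (t * (s - \<rho>)) / ((2 * N * t) * (2 * N * t)) = n * (s - \<rho>) / (4 * N * t)"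
    using params by (simp add: field_simps)
  finally show ?thesis .
qed

lemma block_form_gap:
  assumes "true_weight C1 C2 i j = 0" "i \<in> V" "j \<in> V"
  shows "n\<^sup>2 * (s - \<rho>)^3 / (8 * N\<^sup>2 * t\<^sup>2)
    \<le> block_form \<theta>1 \<theta>2 \<rho> (fraction i) (fraction i) + block_form \<theta>1 \<theta>2 \<rho> (fraction j) (fraction j)
       - 2 * block_form \<theta>1 \<theta>2 \<rho> (fraction i) (fraction j)"
proof -
  define D where "D = n * (s - \<rho>) / (4 * N * t)"
  have D: "0 \<le> D" using params n_pos by (simp add: D_def)
  have "i \<in> C1 \<and> j \<in> C2 \<or> j \<in> C1 \<and> i \<in> C2"
    using assms by (auto simp: true_weight_def)
  then have "D\<^sup>2 \<le> (fraction i - fraction j)\<^sup>2"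
  proof
    assume "i \<in> C1 \<and> j \<in> C2"
    then show ?thesis using fraction_gap[of i j] D unfolding D_def[symmetric] by (intro power_mono) auto
  next
    assume "j \<in> C1 \<and> i \<in> C2"
    then have "D\<^sup>2 \<le> (fraction j - fraction i)\<^sup>2"
      using fraction_gap[of j i] D unfolding D_def[symmetric] by (intro power_mono) auto
    then show ?thesis by (simp add: power2_commute)
  qed
  \<comment> \<open>The curvature \<open>\<theta>1 + \<theta>2 - 2 \<rho>\<close> supplies a third
    factor \<open>s - \<rho>\<close> besides the two from the squared gap.\<close>
  then have "D\<^sup>2 * (2 * (s - \<rho>)) \<le> (fraction i - fraction j)\<^sup>2 * (\<theta>1 + \<theta>2 - 2 * \<rho>)"
    using params by (intro mult_mono) auto
  also have "D\<^sup>2 * (2 * (s - \<rho>)) = n\<^sup>2 * (s - \<rho>)^3 / (8 * N\<^sup>2 * t\<^sup>2)"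
  proof -
    have "(n * z / (4 * N * t))\<^sup>2 * (2 * z) = n\<^sup>2 * z ^ 3 / (8 * N\<^sup>2 * t\<^sup>2)" for z
      by (simp add: power_divide power_mult_distrib power2_eq_square power3_eq_cube)
    then show ?thesis by (simp only: D_def)
  qed
  finally show ?thesis by (simp only: block_form_second_difference)
qed

section \<open>Deterministic estimates on the good event\<close>

context
  fixes g d
  assumes degrees: "good_degrees g d" and d_le: "4 * d \<le> n * s" and ns: "4 \<le> n * s"
begin

text \<open>The two blocks contribute a total error of at most \<open>2 d\<close>, which
  \<open>4 d \<le> n s\<close> makes at most half of the lower bound \<open>n s\<close> for the
  expected degree.\<close>

lemma degree_bounds:
  assumes "i \<in> V"
  shows "n * s / 2 \<le> card (nb g i)" "card (nb g i) \<le> 3 * N * t"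
    and "\<bar>card (nb g i \<inter> C1) / card (nb g i) - fraction i\<bar> \<le> d / (n * s)"
proof -
  define x y where "x = real (card (nb g i \<inter> C1))" and "y = real (card (nb g i \<inter> C2))"
  define a b where "a = card C1 * (if i \<in> C1 then \<theta>1 else \<rho>)"
    and "b = card C2 * (if i \<in> C1 then \<rho> else \<theta>2)"
  have xy: "real (card (nb g i)) = x + y"
    using card_blocks[OF nb_subset[of g i]] by (simp add: x_def y_def)
  have dev: "\<bar>x - a\<bar> \<le> d" "\<bar>y - b\<bar> \<le> d"
    using degrees assms by (auto simp: good_degrees_def x_def y_def a_def b_def)
  have low: "n * s \<le> a + b"
  proof (cases "i \<in> C1")
    case True
    have "n * s \<le> card C1 * \<theta>1" using params n_pos by (intro mult_mono) auto
    then show ?thesis using True probs by (simp add: a_def b_def add_increasing2)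
  next
    case False
    have "n * s \<le> card C2 * \<theta>2" using params n_pos by (intro mult_mono) auto
    then show ?thesis using False probs by (simp add: a_def b_def add_increasing)
  qed
  have up: "a \<le> N * t" "b \<le> N * t"
    using params probs by (auto simp: a_def b_def intro!: mult_mono)
  have "n * s \<le> N * t" using params n_pos by (intro mult_mono) auto
  with low up dev d_le show "n * s / 2 \<le> card (nb g i)" "card (nb g i) \<le> 3 * N * t"
    unfolding xy by auto
  then have "0 < x + y" using ns xy by linarith
  have "fraction i = a / (a + b)" by (simp add: fraction_def a_def b_def)
  moreover have "\<bar>x / (x + y) - a / (a + b)\<bar> \<le> d / (n * s)"
    using \<open>0 < x + y\<close> ns low dev by (intro fraction_deviation_le) (auto simp: x_def y_def)
  ultimately show "\<bar>card (nb g i \<inter> C1) / card (nb g i) - fraction i\<bar> \<le> d / (n * s)"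
    by (simp add: xy x_def)
qed

lemma awcd_N_bounds:
  assumes "i \<in> V" "j \<in> V"
  shows "(n * s)\<^sup>2 / 8 \<le> awcd_N V (adj g) i j" "awcd_N V (adj g) i j \<le> (3 * N * t)\<^sup>2"
proof -
  \<comment> \<open>Since \<open>n s \<ge> 4\<close>, removing 1 from a degree of at least
    \<open>n s / 2\<close> leaves at least \<open>n s / 4\<close>; this covers the case
    \<open>i = j\<close>.\<close>
  have "(n * s)\<^sup>2 / 8 = (n * s / 2) * (n * s / 4)" by (simp add: power2_eq_square)
  also have "\<dots> \<le> real (card (nb g i)) * (real (card (nb g j)) - of_bool (i = j))"
    using degree_bounds(1)[OF assms(1)] degree_bounds(1)[OF assms(2)] ns
    by (intro mult_mono) auto
  finally show "(n * s)\<^sup>2 / 8 \<le> awcd_N V (adj g) i j" by (simp add: awcd_N_def)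
  have "real (card (nb g i)) * (real (card (nb g j)) - of_bool (i = j)) \<le> (3 * N * t) * (3 * N * t)"
    using degree_bounds[OF assms(1)] degree_bounds[OF assms(2)] ns
    by (intro mult_mono) auto
  then show "awcd_N V (adj g) i j \<le> (3 * N * t)\<^sup>2" by (simp add: awcd_N_def power2_eq_square)
qed

context
  fixes u
  assumes S_good: "good_S g u"
begin

text \<open>Four errors add up: fluctuation of \<open>awcd_S\<close> around \<open>S_mean\<close>
  (\<open>u\<close>), excluded rows and diagonal (\<open>9 N t^2\<close>), the shifted denominator
  for \<open>i = j\<close> (\<open>3 N t^2\<close>), all divided by \<open>(n s)^2 / 8\<close>, and
  the passage from empirical to limiting fractions (\<open>2 t d / (n s)\<close>).\<close>

lemma awcd_theta_deviation:
  assumes "i \<in> V" "j \<in> V"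
  shows "\<bar>awcd_theta V (adj g) i j - block_form \<theta>1 \<theta>2 \<rho> (fraction i) (fraction j)\<bar>
    \<le> 8 * (u + 12 * N * t\<^sup>2) / (n * s)\<^sup>2 + 2 * t * d / (n * s)"
proof -
  define xi yi where "xi = real (card (nb g i \<inter> C1))" and "yi = real (card (nb g i \<inter> C2))"
  define xj yj where "xj = real (card (nb g j \<inter> C1))" and "yj = real (card (nb g j \<inter> C2))"
  define Di Dj where "Di = real (card (nb g i))" and "Dj = real (card (nb g j))"
  define Q where "Q = (\<Sum>a\<in>nb g i. \<Sum>b\<in>nb g j. P a b)"
  have D: "Di = xi + yi" "Dj = xj + yj"
    using card_blocks[OF nb_subset[of g i]] card_blocks[OF nb_subset[of g j]]
    by (simp_all add: Di_def Dj_def xi_def yi_def xj_def yj_def)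
  have Db: "n * s / 2 \<le> Di" "Di \<le> 3 * N * t" "n * s / 2 \<le> Dj" "Dj \<le> 3 * N * t"
    using degree_bounds assms by (auto simp: Di_def Dj_def)
  have Dpos: "1 < Di" "1 < Dj" using Db ns by linarith+
  have Q: "Q = xi * xj * \<theta>1 + (xi * yj + yi * xj) * \<rho> + yi * yj * \<theta>2"
    unfolding Q_def sum_P_block[OF nb_subset nb_subset] by (simp add: xi_def xj_def yi_def yj_def)
  have P: "0 \<le> P a b" "P a b \<le> t" for a b
    using edge_prob_bounds t_eq by auto
  have Q0: "0 \<le> Q" "Q \<le> t * (Di * Dj)"
  proof -
    show "0 \<le> Q" unfolding Q_def using P by (intro sum_nonneg)
    have "Q \<le> (\<Sum>a\<in>nb g i. \<Sum>b\<in>nb g j. t)" unfolding Q_def using P by (intro sum_mono)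
    then show "Q \<le> t * (Di * Dj)" by (simp add: Di_def Dj_def mult_ac)
  qed
  have "\<bar>awcd_S V (adj g) i j - S_mean g i j\<bar> \<le> u" using S_good assms by (auto simp: good_S_def)
  moreover have "\<bar>S_mean g i j - Q\<bar> \<le> t * (2 * Di + Dj)"
    using sum_P_off_diagonal[OF nb_subset[of g i] nb_subset[of g j], where t = t and i = i and j = j] params
    by (simp add: S_mean_def Q_def Di_def Dj_def)
  moreover have "t * (2 * Di + Dj) \<le> t * (9 * N * t)" using Db params by (intro mult_left_mono) auto
  ultimately have SQ: "\<bar>awcd_S V (adj g) i j - Q\<bar> \<le> u + 9 * N * t\<^sup>2"
    by (simp add: power2_eq_square mult_ac)
  have tD: "t * Di \<le> 3 * N * t\<^sup>2"
    using mult_left_mono[OF Db(2), of t] params by (simp add: power2_eq_square mult_ac)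
  have "\<bar>awcd_S V (adj g) i j / (Di * (Dj - of_bool (i = j))) - Q / (Di * Dj)\<bar>
      \<le> (u + 9 * N * t\<^sup>2 + 3 * N * t\<^sup>2) / ((n * s)\<^sup>2 / 8)"
    using SQ Q0 Dpos tD params ns awcd_N_bounds(1)[OF assms]
    by (intro ratio_deviation_le[where t = t]) (auto simp: awcd_N_def Di_def Dj_def)
  moreover have "u + 9 * N * t\<^sup>2 + 3 * N * t\<^sup>2 = u + 12 * N * t\<^sup>2" by simp
  moreover have "x / ((n * s)\<^sup>2 / 8) = 8 * x / (n * s)\<^sup>2" for x by simp
  ultimately have 1: "\<bar>awcd_theta V (adj g) i j - Q / (Di * Dj)\<bar> \<le> 8 * (u + 12 * N * t\<^sup>2) / (n * s)\<^sup>2"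
    by (simp only: awcd_theta_def awcd_N_def Di_def Dj_def)
  have form: "Q / (Di * Dj) = block_form \<theta>1 \<theta>2 \<rho> (xi / Di) (xj / Dj)"
  proof -
    have "1 - xi / Di = yi / Di" "1 - xj / Dj = yj / Dj"
      using D Dpos by (auto simp: field_simps)
    then have "block_form \<theta>1 \<theta>2 \<rho> (xi / Di) (xj / Dj)
        = xi / Di * (xj / Dj) * \<theta>1 + (xi / Di * (yj / Dj) + yi / Di * (xj / Dj)) * \<rho> + yi / Di * (yj / Dj) * \<theta>2"
      by (simp only: block_form_def)
    also have "\<dots> = Q / (Di * Dj)"
      by (simp add: Q add_divide_distrib distrib_right)
    finally show ?thesis by simp
  qed
  have "\<bar>Q / (Di * Dj) - block_form \<theta>1 \<theta>2 \<rho> (fraction i) (fraction j)\<bar>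
      \<le> t * (\<bar>xi / Di - fraction i\<bar> + \<bar>xj / Dj - fraction j\<bar>)"
    unfolding form
    using params probs fraction_bounds D Dpos
    by (intro block_form_diff_le) (auto simp: xj_def yj_def)
  also have "\<dots> \<le> t * (d / (n * s) + d / (n * s))"
    unfolding xi_def xj_def Di_def Dj_def
    by (intro mult_left_mono add_mono degree_bounds(3) assms less_imp_le params)
  also have "t * (d / (n * s) + d / (n * s)) = 2 * t * d / (n * s)" by (simp add: mult.left_commute)
  finally have "\<bar>Q / (Di * Dj) - block_form \<theta>1 \<theta>2 \<rho> (fraction i) (fraction j)\<bar> \<le> 2 * t * d / (n * s)" .
  with 1 show ?thesis by linarith
qed

text \<open>On the good event every clause of \<open>awcd_defined\<close> holds, so the default
  value 0 never occurs. The pooled estimator is rewritten as the weighted mean \<open>q\<close>; the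
  remaining conclusions are the side conditions of the entropy bounds.\<close>

lemma awcd_T_eq:
  assumes ij: "i \<in> V" "j \<in> V"
    and \<epsilon>: "8 * (u + 12 * N * t\<^sup>2) / (n * s)\<^sup>2 + 2 * t * d / (n * s) \<le> \<epsilon>" "t + \<epsilon> < 1" "\<epsilon> \<le> s / 4"
  defines "q \<equiv> (awcd_N V (adj g) i i * awcd_theta V (adj g) i i
      + 2 * (awcd_N V (adj g) i j * awcd_theta V (adj g) i j)
      + awcd_N V (adj g) j j * awcd_theta V (adj g) j j)
      / (awcd_N V (adj g) i i + 2 * awcd_N V (adj g) i j + awcd_N V (adj g) j j)"
  shows "awcd_T V (adj g) i j
     = awcd_N V (adj g) i i * bernoulli_KL (awcd_theta V (adj g) i i) q
        + awcd_N V (adj g) j j * bernoulli_KL (awcd_theta V (adj g) j j) q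
        + awcd_N V (adj g) i j * bernoulli_KL (awcd_theta V (adj g) i j) q"
    and "0 < q" "q \<le> t + \<epsilon>"
    and "\<And>k l. k \<in> V \<Longrightarrow> l \<in> V \<Longrightarrow> 0 \<le> awcd_theta V (adj g) k l \<and> awcd_theta V (adj g) k l \<le> t + \<epsilon>"
proof -
  let ?N = "awcd_N V (adj g)" and ?\<theta> = "awcd_theta V (adj g)" and ?S = "awcd_S V (adj g)"
  have ns2: "0 < (n * s)\<^sup>2 / 8" using params n_pos by simp
  have N: "0 < ?N k l" if "k \<in> V" "l \<in> V" for k l
    using awcd_N_bounds(1)[OF that] ns2 by linarith
  show \<theta>: "0 \<le> ?\<theta> k l \<and> ?\<theta> k l \<le> t + \<epsilon>" if "k \<in> V" "l \<in> V" for k l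
  proof
    have "0 \<le> ?S k l" unfolding awcd_S_eq[OF that]
      by (intro sum_nonneg) (simp add: adjacency_matrix_def)
    then show "0 \<le> ?\<theta> k l" using N[OF that] by (simp add: awcd_theta_def)
    have "block_form \<theta>1 \<theta>2 \<rho> (fraction k) (fraction l) \<le> t"
      using params fraction_bounds by (intro block_form_le) auto
    then show "?\<theta> k l \<le> t + \<epsilon>"
      using awcd_theta_deviation[OF that] \<epsilon> by linarith
  qed
  have S: "?S k l = ?N k l * ?\<theta> k l" if "k \<in> V" "l \<in> V" for k l
    using N[OF that] by (simp add: awcd_theta_def)
  have w: "0 < ?N i i + 2 * ?N i j + ?N j j" using N ij by (simp add: add_pos_pos)
  have "?N i i * ?\<theta> i i \<le> ?N i i * (t + \<epsilon>)" "?N i j * ?\<theta> i j \<le> ?N i j * (t + \<epsilon>)"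
    "?N j j * ?\<theta> j j \<le> ?N j j * (t + \<epsilon>)"
    using N \<theta> ij by (auto intro!: mult_left_mono simp: less_imp_le)
  then show q1: "q \<le> t + \<epsilon>"
    unfolding q_def using w by (simp add: pos_divide_le_eq algebra_simps)
  \<comment> \<open>Positivity of \<open>q\<close> comes from a diagonal estimator; across blocks
    the mixed estimator may vanish.\<close>
  have "0 < ?\<theta> i i"
  proof -
    have "s / 2 \<le> block_form \<theta>1 \<theta>2 \<rho> (fraction i) (fraction i)"
      using params probs fraction_bounds by (intro block_form_diag_ge) auto
    then show ?thesis using awcd_theta_deviation[OF ij(1) ij(1)] \<epsilon> params by linarith
  qed
  then show q0: "0 < q"
    unfolding q_def using N \<theta> ij w
    by (intro divide_pos_pos add_pos_nonneg mult_pos_pos mult_nonneg_nonneg) (auto simp: less_imp_le)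
  have join: "awcd_theta_join V (adj g) i j = q"
    using ij by (simp add: awcd_theta_join_def awcd_N_join_def q_def S)
  have "0 \<le> ?\<theta> k l" "?\<theta> k l \<le> 1" if "k \<in> V" "l \<in> V" for k l
    using \<theta>[OF that] \<epsilon>(2) by linarith+
  then have def1: "awcd_defined V (adj g) i j"
    unfolding awcd_defined_def join awcd_N_join_def
    using ij N[of i i] N[of j j] N[of i j] q0 q1 \<epsilon>(2) w by auto
  show "awcd_T V (adj g) i j = ?N i i * bernoulli_KL (?\<theta> i i) q
      + ?N j j * bernoulli_KL (?\<theta> j j) q + ?N i j * bernoulli_KL (?\<theta> i j) q"
    by (simp add: awcd_T_def def1 join)
qed

text \<open>Vertices of one block have the same limiting fraction, so all three estimators are close
  to a single value \<open>\<tau>\<close> in \<open>[s / 2, t]\<close>, and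
  \<open>lo = s / 4\<close> is admissible because \<open>\<epsilon> \<le> s / 4\<close>.\<close>

lemma awcd_T_same_block_le:
  assumes ij: "i \<in> V" "j \<in> V" "true_weight C1 C2 i j = 1"
    and \<epsilon>: "8 * (u + 12 * N * t\<^sup>2) / (n * s)\<^sup>2 + 2 * t * d / (n * s) \<le> \<epsilon>" "t + \<epsilon> + hi \<le> 1" "0 < hi" "\<epsilon> \<le> s / 4"
  shows "awcd_T V (adj g) i j \<le> 12 * (3 * N * t)\<^sup>2 * \<epsilon>\<^sup>2 / (s / 4 * hi)"
proof -
  have frac: "fraction j = fraction i"
    using ij disjoint_blocks by (auto simp: fraction_def true_weight_def)
  define \<tau> where "\<tau> = block_form \<theta>1 \<theta>2 \<rho> (fraction i) (fraction i)"
  have \<tau>: "s / 2 \<le> \<tau>"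
    unfolding \<tau>_def using params probs fraction_bounds by (intro block_form_diag_ge) auto
  have \<tau>': "\<tau> \<le> t"
    unfolding \<tau>_def using params probs fraction_bounds by (intro block_form_le) auto
  have dev: "\<bar>awcd_theta V (adj g) k l - \<tau>\<bar> \<le> \<epsilon>" if "k \<in> {i, j}" "l \<in> {i, j}" for k l
    using awcd_theta_deviation[of k l] that ij frac \<epsilon>(1) by (auto simp: \<tau>_def)
  have \<epsilon>': "t + \<epsilon> < 1" using \<epsilon> by linarith
  have N: "0 < awcd_N V (adj g) k l" "awcd_N V (adj g) k l \<le> (3 * N * t)\<^sup>2" if "k \<in> V" "l \<in> V" for k l
  proof -
    have "0 < (n * s)\<^sup>2 / 8" using params n_pos by simp
    then show "0 < awcd_N V (adj g) k l" using awcd_N_bounds(1)[OF that] by linarith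
  qed (use awcd_N_bounds that in auto)
  note T = awcd_T_eq[OF ij(1,2) \<epsilon>(1) \<epsilon>' \<epsilon>(4)]
  have \<theta>: "0 \<le> awcd_theta V (adj g) k l" "awcd_theta V (adj g) k l \<le> 1" if "k \<in> V" "l \<in> V" for k l
    using T(4)[OF that] \<epsilon>' by auto
  show ?thesis
    unfolding T(1)
  proof (rule KL_sum_same_le[where \<tau> = \<tau>])
    show "s / 4 + \<epsilon> \<le> \<tau>" "\<tau> + \<epsilon> + hi \<le> 1" "0 < s / 4"
      using \<tau> \<tau>' \<epsilon>(2,4) params by linarith+
  qed (intro N \<theta> dev \<epsilon>(3) ij refl insertI1 insertI2 singletonI)+
qed

lemma awcd_T_distinct_blocks_ge:
  assumes ij: "i \<in> V" "j \<in> V" "true_weight C1 C2 i j = 0"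
    and \<epsilon>: "8 * (u + 12 * N * t\<^sup>2) / (n * s)\<^sup>2 + 2 * t * d / (n * s) \<le> \<epsilon>" "t + \<epsilon> < 1" "\<epsilon> \<le> s / 4"
    and \<Delta>: "\<Delta> = n\<^sup>2 * (s - \<rho>)^3 / (8 * N\<^sup>2 * t\<^sup>2)" "8 * \<epsilon> \<le> \<Delta>"
  shows "(n * s)\<^sup>2 / 8 * (\<Delta> / 2)\<^sup>2 / (24 * (2 * t)) \<le> awcd_T V (adj g) i j"
proof -
  let ?\<theta> = "awcd_theta V (adj g)"
  note T = awcd_T_eq[OF ij(1,2) \<epsilon>]
  have "\<Delta> \<le> block_form \<theta>1 \<theta>2 \<rho> (fraction i) (fraction i) + block_form \<theta>1 \<theta>2 \<rho> (fraction j) (fraction j)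
       - 2 * block_form \<theta>1 \<theta>2 \<rho> (fraction i) (fraction j)"
    unfolding \<Delta> by (rule block_form_gap) (use ij in auto)
  \<comment> \<open>The second difference loses at most \<open>(1 + 1 + 2) \<epsilon>\<close>, and
    \<open>8 \<epsilon> \<le> \<Delta>\<close> makes this at most half of
    \<open>\<Delta>\<close>.\<close>
  then have "\<Delta> / 2 \<le> ?\<theta> i i + ?\<theta> j j - 2 * ?\<theta> i j"
    using order.trans[OF awcd_theta_deviation[OF ij(1) ij(1)] \<epsilon>(1)]
      order.trans[OF awcd_theta_deviation[OF ij(2) ij(2)] \<epsilon>(1)]
      order.trans[OF awcd_theta_deviation[OF ij(1) ij(2)] \<epsilon>(1)] \<Delta>(2) by linarith
  moreover have "0 \<le> \<Delta>" using params n_pos by (simp add: \<Delta>)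
  ultimately have "(\<Delta> / 2)\<^sup>2 \<le> (?\<theta> i i + ?\<theta> j j - 2 * ?\<theta> i j)\<^sup>2"
    by (intro power_mono) auto
  then have "(n * s)\<^sup>2 / 8 * (\<Delta> / 2)\<^sup>2 / (24 * (2 * t))
      \<le> (n * s)\<^sup>2 / 8 * (?\<theta> i i + ?\<theta> j j - 2 * ?\<theta> i j)\<^sup>2 / (24 * (2 * t))"
    using params by (intro divide_right_mono mult_left_mono) auto
  also have "\<dots> \<le> awcd_T V (adj g) i j"
  proof -
    have \<theta>: "0 \<le> ?\<theta> k l" "?\<theta> k l \<le> 1" "?\<theta> k l \<le> 2 * t" if "k \<in> V" "l \<in> V" for k l
      using T(4)[OF that] \<epsilon> params by auto
    have t2: "t + \<epsilon> \<le> 2 * t" using \<epsilon>(3) params by linarith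
    show ?thesis
      unfolding T(1)
      by (rule KL_sum_ge) (intro \<theta> ij awcd_N_bounds T(2) order.trans[OF T(3) t2]
        order.strict_trans1[OF T(3) \<epsilon>(2)] | simp)+
  qed
  finally show ?thesis .
qed

end

end

end

section \<open>Probability of the good event\<close>

context sized_two_block_model
begin

abbreviation prb :: "nat set \<Rightarrow> real" where "prb \<equiv> edge_prob C1 C2 \<theta>1 \<theta>2 \<rho>"

definition graph_pmf :: "(nat set \<Rightarrow> bool) pmf" where
  "graph_pmf = Pi_pmf (vertex_pairs V) False (\<lambda>e. bernoulli_pmf (prb e))"

lemma finite_vertex_pairs: "finite (vertex_pairs V)"
  by (rule finite_subset[of _ "Pow V"]) (auto simp: vertex_pairs_def finite_blocks)

lemma prb_le: "prb e \<le> t"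
  using edge_prob_bounds(2) t_eq by simp

lemma degree_tail:
  fixes c :: real
  assumes i: "i \<in> V" and C: "C \<subseteq> V" "card C \<le> N" and c: "\<And>a. a \<in> C \<Longrightarrow> P i a = c"
    and L: "1 \<le> L" "9 * L \<le> N * t"
  shows "measure_pmf.prob graph_pmf
      {g. \<bar>real (card (nb g i \<inter> C)) - card C * c\<bar> > 6 * sqrt (N * t * L)} \<le> 2 * exp (- 6 * L)"
proof -
  define F where "F = (\<lambda>a. {i, a}) ` (C - {i})"
  have finC: "finite C" using C finite_V finite_subset by blast
  have inj: "inj_on (\<lambda>a. {i, a}) (C - {i})" by (auto simp: inj_on_def doubleton_eq_iff)
  have F: "F \<subseteq> vertex_pairs V" using i C by (auto simp: F_def vertex_pairs_def)
  have cardC: "real (card C) * c = (\<Sum>a\<in>C - {i}. P i a) + of_bool (i \<in> C) * c"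
  proof -
    have "real (card C) * c = (\<Sum>a\<in>C. P i a)" using c by simp
    then show ?thesis
      using sum.remove[OF finC, of i "P i"] c[of i] by (cases "i \<in> C") auto
  qed
  have sumF: "(\<Sum>e\<in>F. h e) = (\<Sum>a\<in>C - {i}. h {i, a})" for h :: "nat set \<Rightarrow> real"
    unfolding F_def by (simp add: sum.reindex[OF inj])
  have ct: "0 \<le> of_bool (i \<in> C) * c" "of_bool (i \<in> C) * c \<le> 1"
    using c[of i] edge_prob_bounds(1,3)[of "{i, i}"] by auto
  have v: "(\<Sum>e\<in>F. prb e) \<le> N * t"
  proof -
    have "(\<Sum>e\<in>F. prb e) \<le> real (card (C - {i})) * t"
      unfolding sumF by (intro sum_bounded_above prb_le)
    also have "\<dots> \<le> N * t"
      using C(2) card_mono[OF finC, of "C - {i}"] params(13) by (intro mult_right_mono) auto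
    finally show ?thesis .
  qed
  \<comment> \<open>This pays for the absent loop at \<open>i\<close>, of mean at most 1, by the
    step from the factor 5 to the factor 6.\<close>
  have one: "1 \<le> sqrt (N * t * L)"
    using mult_mono[of 1 "N * t" 1 L] L by simp
  have "{g. \<bar>real (card (nb g i \<inter> C)) - card C * c\<bar> > 6 * sqrt (N * t * L)}
      \<subseteq> {g. \<bar>\<Sum>e\<in>F. of_bool (g e) - prb e\<bar> \<ge> 5 * sqrt (N * t * L)}"
  proof safe
    fix g
    assume far: "\<bar>real (card (nb g i \<inter> C)) - card C * c\<bar> > 6 * sqrt (N * t * L)"
    have "nb g i \<inter> C = {a \<in> C - {i}. g {i, a}}" using i C by (auto simp: nb_eq)
    then have "real (card (nb g i \<inter> C)) = (\<Sum>a\<in>C - {i}. of_bool (g {i, a}))"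
      using finC by (simp add: Int_def)
    then have "real (card (nb g i \<inter> C)) - card C * c
        = (\<Sum>e\<in>F. of_bool (g e) - prb e) - of_bool (i \<in> C) * c"
      by (simp add: sumF cardC sum_subtractf)
    then show "\<bar>\<Sum>e\<in>F. of_bool (g e) - prb e\<bar> \<ge> 5 * sqrt (N * t * L)"
      using far ct one by linarith
  qed
  then have "measure_pmf.prob graph_pmf {g. \<bar>real (card (nb g i \<inter> C)) - card C * c\<bar> > 6 * sqrt (N * t * L)}
      \<le> measure_pmf.prob graph_pmf {g. \<bar>\<Sum>e\<in>F. of_bool (g e) - prb e\<bar> \<ge> 5 * sqrt (N * t * L)}"
    by (intro measure_pmf.finite_measure_mono) auto
  also have "\<dots> \<le> 2 * exp (- 6 * L)"
    unfolding graph_pmf_def using F v L finite_vertex_pairs edge_prob_bounds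
    by (intro Pi_bernoulli_deviation) auto
  finally show ?thesis .
qed

text \<open>With the edges at \<open>i\<close> or \<open>j\<close> frozen, the neighbourhoods and
  the degree conditions are fixed and \<open>awcd_S\<close> counts independent edges. An edge inside
  both neighbourhoods is counted as \<open>(a, b)\<close> and as \<open>(b, a)\<close>; splitting by
  the order of \<open>a\<close> and \<open>b\<close> restores independence and doubles both the
  deviation and the probability.\<close>

lemma S_tail:
  assumes ij: "i \<in> V" "j \<in> V" and L: "0 < L" "L \<le> N\<^sup>2 * t ^ 3"
  shows "measure_pmf.prob graph_pmf
      {g. card (nb g i) \<le> 3 * N * t \<and> card (nb g j) \<le> 3 * N * t \<and>
          \<bar>awcd_S V (adj g) i j - S_mean g i j\<bar> \<ge> 30 * N * t * sqrt (t * L)} \<le> 4 * exp (- 6 * L)"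
  unfolding graph_pmf_def
proof (rule Pi_pmf_conditional_bound)
  define E1 where "E1 = {e \<in> vertex_pairs V. i \<in> e \<or> j \<in> e}"
  show "finite (vertex_pairs V)" "E1 \<subseteq> vertex_pairs V"
    using finite_vertex_pairs by (auto simp: E1_def)
  fix f :: "nat set \<Rightarrow> bool"
  let ?E = "vertex_pairs V - E1"
  let ?M = "Pi_pmf ?E False (\<lambda>e. bernoulli_pmf (prb e))"
  let ?g = "\<lambda>(g :: nat set \<Rightarrow> bool) x. if x \<in> E1 then f x else g x"
  let ?bad = "\<lambda>g. card (nb g i) \<le> 3 * N * t \<and> card (nb g j) \<le> 3 * N * t \<and>
          \<bar>awcd_S V (adj g) i j - S_mean g i j\<bar> \<ge> 30 * N * t * sqrt (t * L)"
  have nb: "nb (?g g) k = nb f k" if "k \<in> {i, j}" for g k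
  proof -
    have "k \<in> V" "{k, a} \<in> E1" if "a \<in> V" "a \<noteq> k" for a
      using that \<open>k \<in> {i, j}\<close> ij by (auto simp: E1_def vertex_pairs_def)
    then show ?thesis using that ij by (auto simp: nb_eq)
  qed
  define A B where "A = nb f i - {j}" and "B = nb f j - {i}"
  have AB: "A \<subseteq> V - {i, j}" "B \<subseteq> V - {i, j}"
    using ij by (auto simp: A_def B_def nb_eq)
  have finAB: "finite A" "finite B" using finite_nb by (auto simp: A_def B_def)
  show "measure_pmf.prob ?M {g. ?bad (?g g)} \<le> 4 * exp (- 6 * L)"
  proof (cases "card (nb f i) \<le> 3 * N * t \<and> card (nb f j) \<le> 3 * N * t")
    case False
    then have "{g. ?bad (?g g)} = {}" using nb by auto
    then show ?thesis by (simp only: measure_empty) simp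
  next
    case True
    define v where "v = (3 * N * t)\<^sup>2 * t"
    define X where "X = {(a, b). a \<in> A \<and> b \<in> B \<and> a < b}"
    define Y where "Y = {(a, b). a \<in> A \<and> b \<in> B \<and> b < a}"
    define e where "e = (\<lambda>(a :: nat, b :: nat). {a, b})"
    have vL: "5 * sqrt (v * L) = 15 * N * t * sqrt (t * L)"
      using params by (simp add: v_def real_sqrt_mult)
    have XY: "X \<subseteq> A \<times> B" "Y \<subseteq> A \<times> B" "X \<inter> Y = {}" by (auto simp: X_def Y_def)
    have finXY: "finite X" "finite Y" using XY finAB finite_subset[OF _ finite_cartesian_product] by blast+
    have inj: "inj_on e X" "inj_on e Y"
      by (auto simp: inj_on_def e_def X_def Y_def doubleton_eq_iff)
    have tail: "measure_pmf.prob ?M {g. \<bar>\<Sum>x\<in>Z. of_bool (g (e x)) - prb (e x)\<bar> \<ge> 15 * N * t * sqrt (t * L)}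
        \<le> 2 * exp (- 6 * L)" if Z: "Z \<subseteq> A \<times> B" "inj_on e Z" "\<forall>(a, b)\<in>Z. a \<noteq> b" for Z
    proof -
      have finZ: "finite Z" using Z finAB finite_subset[OF _ finite_cartesian_product] by blast
      have "(\<Sum>d\<in>e ` Z. prb d) \<le> real (card (e ` Z)) * t"
        using prb_le by (intro sum_bounded_above) auto
      also have "real (card (e ` Z)) \<le> real (card (A \<times> B))"
        using card_image_le[OF finZ] card_mono[OF finite_cartesian_product[OF finAB] Z(1)]
        by (meson of_nat_le_iff order.trans)
      also have "real (card (A \<times> B)) \<le> real (card (nb f i)) * real (card (nb f j))"
        unfolding card_cartesian_product of_nat_mult A_def B_def
        by (intro mult_mono of_nat_mono card_mono finite_nb) auto
      also have "\<dots> \<le> (3 * N * t) * (3 * N * t)"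
        using True params by (intro mult_mono) auto
      finally have v: "(\<Sum>d\<in>e ` Z. prb d) \<le> v"
        using params by (simp add: v_def power2_eq_square)
      \<comment> \<open>Here \<open>v = 9 N^2 t^3\<close>, which explains the upper bound on
        \<open>L\<close> in the statement.\<close>
      have "9 * L \<le> v" using L by (simp add: v_def power2_eq_square power3_eq_cube mult_ac)
      moreover have "e ` Z \<subseteq> ?E"
        using Z AB by (fastforce simp: e_def E1_def vertex_pairs_def)
      ultimately have "measure_pmf.prob ?M {g. \<bar>\<Sum>d\<in>e ` Z. of_bool (g d) - prb d\<bar> \<ge> 5 * sqrt (v * L)}
          \<le> 2 * exp (- 6 * L)"
        using v L finite_vertex_pairs edge_prob_bounds by (intro Pi_bernoulli_deviation) auto
      then show ?thesis by (simp add: sum.reindex[OF Z(2)] vL)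
    qed
    have S: "awcd_S V (adj (?g g)) i j - S_mean (?g g) i j
        = (\<Sum>x\<in>X. of_bool (g (e x)) - prb (e x)) + (\<Sum>x\<in>Y. of_bool (g (e x)) - prb (e x))" for g
    proof -
      have entry: "adj (?g g) a b - of_bool (a \<noteq> b) * P a b
          = (if a < b then of_bool (g {a, b}) - P a b else 0) + (if b < a then of_bool (g {a, b}) - P a b else 0)"
        if "a \<in> A" "b \<in> B" for a b
      proof -
        have "{a, b} \<notin> E1" "a \<in> V" "b \<in> V" using that AB by (auto simp: E1_def)
        then show ?thesis by (auto simp: adj_eq)
      qed
      have "awcd_S V (adj (?g g)) i j - S_mean (?g g) i j
          = (\<Sum>a\<in>A. \<Sum>b\<in>B. adj (?g g) a b - of_bool (a \<noteq> b) * P a b)"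
        unfolding awcd_S_eq[OF ij] S_mean_def nb[of i, simplified] nb[of j, simplified] A_def B_def
        by (simp only: sum_subtractf)
      also have "\<dots> = (\<Sum>a\<in>A. \<Sum>b\<in>B. (if a < b then of_bool (g {a, b}) - P a b else 0)
          + (if b < a then of_bool (g {a, b}) - P a b else 0))"
        by (rule sum.cong[OF refl], rule sum.cong[OF refl], rule entry)
      also have "\<dots> = (\<Sum>x\<in>A \<times> B. if x \<in> X then of_bool (g (e x)) - prb (e x) else 0)
          + (\<Sum>x\<in>A \<times> B. if x \<in> Y then of_bool (g (e x)) - prb (e x) else 0)"
        unfolding sum.cartesian_product sum.distrib[symmetric]
        by (rule sum.cong[OF refl]) (auto simp: X_def Y_def e_def split: if_splits)
      also have "\<dots> = (\<Sum>x\<in>X. of_bool (g (e x)) - prb (e x)) + (\<Sum>x\<in>Y. of_bool (g (e x)) - prb (e x))"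
      proof -
        have *: "(\<Sum>x\<in>A \<times> B. if x \<in> Z then h x else 0) = (\<Sum>x\<in>Z. h x)"
          if "Z \<subseteq> A \<times> B" for Z and h :: "nat \<times> nat \<Rightarrow> real"
          using sum.inter_restrict[of "A \<times> B" h Z] that finAB by (simp add: Int_absorb1)
        show ?thesis by (simp only: *[OF XY(1)] *[OF XY(2)])
      qed
      finally show ?thesis .
    qed
    let ?T = "\<lambda>Z. {g. \<bar>\<Sum>x\<in>Z. of_bool (g (e x)) - prb (e x)\<bar> \<ge> 15 * N * t * sqrt (t * L)}"
    have "{g. ?bad (?g g)} \<subseteq> ?T X \<union> ?T Y"
    proof
      fix g assume "g \<in> {g. ?bad (?g g)}"
      then have "\<bar>awcd_S V (adj (?g g)) i j - S_mean (?g g) i j\<bar> \<ge> 30 * N * t * sqrt (t * L)" unfolding mem_Collect_eq by (elim conjE)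
      then show "g \<in> ?T X \<union> ?T Y" unfolding S Un_iff mem_Collect_eq by linarith
    qed
    then have "measure_pmf.prob ?M {g. ?bad (?g g)} \<le> measure_pmf.prob ?M (?T X \<union> ?T Y)"
      by (intro measure_pmf.finite_measure_mono) auto
    also have "\<dots> \<le> measure_pmf.prob ?M (?T X) + measure_pmf.prob ?M (?T Y)"
      by (intro measure_Un_le) auto
    also have "\<dots> \<le> 2 * exp (- 6 * L) + 2 * exp (- 6 * L)"
      by (intro add_mono tail XY inj) (auto simp: X_def Y_def)
    finally show ?thesis by simp
  qed
qed

lemma good_event_prob:
  assumes L: "1 \<le> L" "9 * L \<le> N * t" "L \<le> N\<^sup>2 * t ^ 3"
    and d: "d = 6 * sqrt (N * t * L)" "4 * d \<le> n * s" "4 \<le> n * s"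
    and u: "u = 30 * N * t * sqrt (t * L)"
  shows "measure_pmf.prob graph_pmf {g. \<not> (good_degrees g d \<and> good_S g u)} \<le> 32 * N\<^sup>2 * exp (- 6 * L)"
proof -
  let ?p1 = "\<lambda>i. if i \<in> C1 then \<theta>1 else \<rho>" and ?p2 = "\<lambda>i. if i \<in> C1 then \<rho> else \<theta>2"
  define B1 where "B1 = (\<lambda>i. {g. \<bar>real (card (nb g i \<inter> C1)) - card C1 * ?p1 i\<bar> > d})"
  define B2 where "B2 = (\<lambda>i. {g. \<bar>real (card (nb g i \<inter> C2)) - card C2 * ?p2 i\<bar> > d})"
  define B3 where "B3 = (\<lambda>(i, j). {g. card (nb g i) \<le> 3 * N * t \<and> card (nb g j) \<le> 3 * N * t \<and>
          \<bar>awcd_S V (adj g) i j - S_mean g i j\<bar> \<ge> u})"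
  let ?p = "\<lambda>X. measure_pmf.prob graph_pmf X"
  have 1: "?p (B1 i) \<le> 2 * exp (- 6 * L)" if "i \<in> V" for i
    unfolding B1_def d
    by (rule degree_tail) (use that L params disjoint_blocks in \<open>auto simp: P_eq\<close>)
  have 2: "?p (B2 i) \<le> 2 * exp (- 6 * L)" if "i \<in> V" for i
    unfolding B2_def d
    by (rule degree_tail) (use that L params disjoint_blocks in \<open>auto simp: P_eq\<close>)
  have 3: "?p (B3 x) \<le> 4 * exp (- 6 * L)" if "x \<in> V \<times> V" for x
    using S_tail[of "fst x" "snd x" L] that L by (auto simp: B3_def u)
  have "{g. \<not> (good_degrees g d \<and> good_S g u)}
      \<subseteq> (\<Union>i\<in>V. B1 i) \<union> (\<Union>i\<in>V. B2 i) \<union> (\<Union>x\<in>V \<times> V. B3 x)"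
  proof
    fix g assume "g \<in> {g. \<not> (good_degrees g d \<and> good_S g u)}"
    then consider "\<not> good_degrees g d" | "good_degrees g d" "\<not> good_S g u" by blast
    then show "g \<in> (\<Union>i\<in>V. B1 i) \<union> (\<Union>i\<in>V. B2 i) \<union> (\<Union>x\<in>V \<times> V. B3 x)"
    proof cases
      case 1
      then obtain i where "i \<in> V" "g \<in> B1 i \<or> g \<in> B2 i"
        by (auto simp: good_degrees_def B1_def B2_def not_le)
      then show ?thesis by blast
    next
      case 2
      note good = 2(1)
      from 2 obtain i j where ij: "i \<in> V" "j \<in> V" "\<bar>awcd_S V (adj g) i j - S_mean g i j\<bar> \<ge> u"
        by (fastforce simp: good_S_def not_le)
      \<comment> \<open>Good degrees supply the degree conditions built into \<open>B3\<close>, so a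
        failure of \<open>good_S\<close> alone falls into these events.\<close>
      then have "g \<in> B3 (i, j)"
        using degree_bounds(2)[OF good d(2,3)] by (auto simp: B3_def)
      then show ?thesis using ij by blast
    qed
  qed
  then have "?p {g. \<not> (good_degrees g d \<and> good_S g u)}
      \<le> ?p ((\<Union>i\<in>V. B1 i) \<union> (\<Union>i\<in>V. B2 i) \<union> (\<Union>x\<in>V \<times> V. B3 x))"
    by (intro measure_pmf.finite_measure_mono) auto
  also have "\<dots> \<le> ?p (\<Union>i\<in>V. B1 i) + ?p (\<Union>i\<in>V. B2 i) + ?p (\<Union>x\<in>V \<times> V. B3 x)"
    by (intro order.trans[OF measure_Un_le] add_mono measure_Un_le) auto
  also have "\<dots> \<le> (\<Sum>i\<in>V. 2 * exp (- 6 * L)) + (\<Sum>i\<in>V. 2 * exp (- 6 * L)) + (\<Sum>x\<in>V \<times> V. 4 * exp (- 6 * L))"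
    using finite_V 1 2 3
    by (intro add_mono order.trans[OF measure_UNION_le] sum_mono) auto
  also have "\<dots> = (4 * real (card V) + 4 * (real (card V))\<^sup>2) * exp (- 6 * L)"
    by (simp add: card_cartesian_product power2_eq_square algebra_simps)
  also have "\<dots> \<le> (32 * N\<^sup>2) * exp (- 6 * L)"
  proof (intro mult_right_mono)
    have V: "card V \<le> 2 * N"
      using params card_Un_le[of C1 C2] by linarith
    have "V \<noteq> {}" using params n_pos by auto
    then have "1 \<le> real (card V)" using finite_V by (simp add: Suc_le_eq card_gt_0_iff)
    then have "real (card V) \<le> (real (card V))\<^sup>2" by (rule self_le_power) simp
    moreover have "(real (card V))\<^sup>2 \<le> (2 * N)\<^sup>2" using V by (intro power_mono) auto
    moreover have "(2 * N)\<^sup>2 = 4 * N\<^sup>2" by (rule four_x_squared[symmetric])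
    moreover have "4 * x + 4 * y \<le> 32 * z" if "x \<le> y" "y \<le> w" "w = 4 * z" for w x y z :: real
      using that by linarith
    ultimately show "4 * real (card V) + 4 * (real (card V))\<^sup>2 \<le> 32 * N\<^sup>2" by blast
  qed auto
  finally show ?thesis .
qed

end

section \<open>Consequences of the separation condition\<close>

text \<open>Here \<open>\<delta> = s - \<rho>\<close>, \<open>w = sqrt (t * L)\<close>, and the last two
  assumptions are the cubes of the two branches of the separation condition.\<close>

locale separation_regime =
  fixes n N r s t q \<delta> L c w :: real
  assumes n: "1 \<le> n" and r: "1 \<le> r" and q: "1 \<le> q" and s: "0 < s" "t \<le> 1"
    and t_eq: "t = q * s" and N_eq: "N = r * n"
    and \<delta>: "0 < \<delta>" "\<delta> \<le> s" and L: "1 \<le> L" and c: "0 < c" "c \<le> 1 / 1000"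
    and w: "0 < w" "w\<^sup>2 = t * L"
    and K1: "q ^ 7 * r ^ 6 * t * w \<le> c ^ 3 * \<delta> ^ 3 * n"
    and K2: "q ^ 7 * r ^ 6 * t\<^sup>2 * w \<le> c ^ 3 * \<delta> ^ 3 * sqrt n"
begin

lemma s_le_t: "s \<le> t" using s q by (simp add: t_eq)
lemma t_pos: "0 < t" using s s_le_t by linarith
lemma n_le_N: "n \<le> N" using r n by (simp add: N_eq)
lemma delta_le_t: "\<delta> \<le> t" using \<delta> s_le_t by linarith

lemma c_cubed: "c ^ 3 \<le> 1 / 1000000000"
  using power_mono[OF c(2), of 3] c by (simp add: power3_eq_cube)

lemma delta_cubed: "\<delta> ^ 3 \<le> t\<^sup>2 * s" "\<delta> ^ 3 \<le> t\<^sup>2 * \<delta>"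
proof -
  have "\<delta> ^ 3 = \<delta> * \<delta> * \<delta>" by (simp add: power3_eq_cube)
  also have "\<dots> \<le> t * t * \<delta>" using \<delta> delta_le_t t_pos by (intro mult_mono) auto
  finally show "\<delta> ^ 3 \<le> t\<^sup>2 * \<delta>" by (simp add: power2_eq_square)
  also have "\<dots> \<le> t\<^sup>2 * s" using \<delta> by (intro mult_left_mono) auto
  finally show "\<delta> ^ 3 \<le> t\<^sup>2 * s" .
qed

lemma w_ge: "t \<le> w"
proof (rule power2_le_imp_le)
  have "t\<^sup>2 \<le> t * L" using t_pos s L by (auto simp: power2_eq_square intro!: mult_left_mono)
  then show "t\<^sup>2 \<le> w\<^sup>2" by (simp add: w)
qed (use w in simp)

text \<open>Since \<open>\<delta>^3 \<le> t^2 s\<close>, a factor \<open>t^2\<close> cancels from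
  \<open>K2\<close>. The bounds on \<open>r\<close>, \<open>N\<close> and \<open>L\<close> by
  \<open>n\<close> all start here.\<close>

lemma w_le_sqrt: "q ^ 7 * r ^ 6 * w \<le> c ^ 3 * s * sqrt n"
proof -
  have "t\<^sup>2 * (q ^ 7 * r ^ 6 * w) \<le> c ^ 3 * \<delta> ^ 3 * sqrt n" using K2 by (simp add: mult_ac)
  also have "\<dots> \<le> c ^ 3 * (t\<^sup>2 * s) * sqrt n"
    using delta_cubed c n by (intro mult_right_mono mult_left_mono) auto
  finally have "t\<^sup>2 * (q ^ 7 * r ^ 6 * w) \<le> t\<^sup>2 * (c ^ 3 * s * sqrt n)" by (simp add: mult_ac)
  then show ?thesis using t_pos by (simp only: mult_le_cancel_left_pos zero_less_power)
qed

lemma powers_ge: "1 \<le> q ^ 7" "1 \<le> r ^ 6" "r \<le> r ^ 6" "1 \<le> q ^ 7 * r ^ 6" "r \<le> q ^ 7 * r ^ 6"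
proof -
  show 1: "1 \<le> q ^ 7" "1 \<le> r ^ 6" using q r by auto
  show 2: "r \<le> r ^ 6" using r by (intro self_le_power) auto
  show "1 \<le> q ^ 7 * r ^ 6" "r \<le> q ^ 7 * r ^ 6"
    using mult_mono[OF 1] mult_mono[OF 1(1) 2] r q by auto
qed

lemma r_w_le: "r * w \<le> c ^ 3 * s * sqrt n"
  using w_le_sqrt mult_right_mono[OF powers_ge(5), of w] w by linarith

text \<open>The condition forces \<open>r \<le> sqrt n\<close>. The number of vertex pairs is thus
  polynomial in \<open>n\<close>, as the union bound requires.\<close>

lemma N_le: "N \<le> n\<^sup>2"
proof -
  have "r * s \<le> r * w" using w_ge s_le_t r by (intro mult_left_mono) auto
  also note r_w_le
  also have "c ^ 3 * s * sqrt n \<le> 1 * s * sqrt n"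
    using c_cubed s n by (intro mult_right_mono) auto
  finally have "r \<le> sqrt n" using s by (simp add: mult.commute)
  also have "\<dots> \<le> n" using n by (simp add: real_le_lsqrt self_le_power)
  finally show ?thesis using n by (simp add: N_eq power2_eq_square)
qed

text \<open>Square \<open>r_w_le\<close>, using \<open>r \<ge> 1\<close> and
  \<open>w^2 = t L\<close>; the constant is the square of the bound on \<open>c^3\<close>.\<close>

lemma L_le: "1000000000000000000 * L \<le> n * s"
proof -
  have "w \<le> r * w" using r w by simp
  also note r_w_le
  also have "c ^ 3 * s * sqrt n \<le> 1 / 1000000000 * s * sqrt n"
    using c_cubed s n by (intro mult_right_mono) auto
  finally have "w\<^sup>2 \<le> (1 / 1000000000 * s * sqrt n)\<^sup>2" using w by (intro power_mono) auto
  also have "\<dots> = 1 / 1000000000000000000 * (s * (s * n))" using n by (simp add: power_mult_distrib power2_eq_square)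
  finally have "1000000000000000000 * (t * L) \<le> s * (s * n)" by (simp add: w)
  moreover have "s * L \<le> t * L" using s_le_t L by (intro mult_right_mono) auto
  ultimately have "s * (1000000000000000000 * L) \<le> s * (s * n)" by (simp add: mult_ac)
  then show ?thesis using s by (simp add: mult_le_cancel_left mult.commute)
qed

lemma ns_ge: "4 \<le> n * s" using L_le L by linarith

lemma L_le_degree: "9 * L \<le> N * t"
proof -
  have "n * s \<le> N * t" using n_le_N s_le_t n s by (intro mult_mono) auto
  then show ?thesis using L_le L by linarith
qed

text \<open>The first branch, with \<open>\<delta>^3 \<le> t^2 s\<close>, gives
  \<open>w \<le> t^2 N\<close>, and squaring yields the size condition of
  \<open>S_tail\<close>.\<close>

lemma L_le_wedges: "L \<le> N\<^sup>2 * t ^ 3"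
proof -
  have "t * w \<le> q ^ 7 * r ^ 6 * (t * w)" using mult_right_mono[OF powers_ge(4), of "t * w"] t_pos w by simp
  also have "\<dots> \<le> c ^ 3 * \<delta> ^ 3 * n" using K1 by (simp add: mult_ac)
  also have "\<dots> \<le> 1 * (t\<^sup>2 * s) * n"
    using c_cubed delta_cubed c n \<delta> t_pos by (intro mult_right_mono mult_mono) auto
  also have "\<dots> \<le> t\<^sup>2 * t * N"
    using s_le_t t_pos n_le_N n s unfolding mult_1 by (intro mult_mono) auto
  finally have "t * w \<le> t * (t\<^sup>2 * N)" by (simp add: mult_ac)
  then have "w \<le> t\<^sup>2 * N" using t_pos by (simp add: mult_le_cancel_left)
  then have "w\<^sup>2 \<le> (t\<^sup>2 * N)\<^sup>2" using w by (intro power_mono) auto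
  then have "t * L \<le> t * (N\<^sup>2 * t ^ 3)" unfolding w
    by (simp add: power2_eq_square power3_eq_cube mult_ac)
  then show ?thesis using t_pos by (simp add: mult_le_cancel_left)
qed

section \<open>Estimation error against the gap between blocks\<close>

definition deviation :: real where "deviation = 6 * sqrt (N * t * L)"

lemma deviation_le: "deviation \<le> 6 * r * sqrt n * w"
proof -
  have "sqrt (N * t * L) = sqrt r * sqrt n * sqrt (w\<^sup>2)"
    unfolding w(2) N_eq real_sqrt_mult[symmetric] by (simp add: mult_ac)
  also have "\<dots> \<le> r * sqrt n * w"
  proof -
    have "sqrt r \<le> r" using r by (simp add: real_le_lsqrt self_le_power)
    then show ?thesis using n w(1) by (simp add: mult_right_mono)
  qed
  finally show ?thesis by (simp add: deviation_def)
qed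

lemma deviation_small: "4 * deviation \<le> n * s"
proof -
  have "deviation \<le> 6 * (r * w) * sqrt n" using deviation_le by (simp add: mult_ac)
  also have "\<dots> \<le> 6 * (c ^ 3 * s * sqrt n) * sqrt n"
    using r_w_le n by (intro mult_right_mono mult_left_mono) auto
  also have "\<dots> = c ^ 3 * (6 * (n * s))" using n by simp
  also have "\<dots> \<le> 1 / 1000000000 * (6 * (n * s))"
    using c_cubed n s by (intro mult_right_mono) auto
  finally show ?thesis using ns_ge by linarith
qed

text \<open>The constant is \<open>336 + 12\<close>, the contributions of \<open>K1\<close> and
  \<open>K2\<close> in \<open>error_bound\<close>. Both errors have order \<open>q^2 r\<close> in
  the ratios, which leaves \<open>q^5 r^5\<close> from the factor \<open>q^7 r^6\<close> of the
  assumptions.\<close>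

definition error :: real where "error = 348 * (c ^ 3 * \<delta> ^ 3) / (q ^ 5 * r ^ 5 * t\<^sup>2)"

lemma error_bound:
  "8 * (30 * N * t * w + 12 * N * t\<^sup>2) / (n * s)\<^sup>2 + 2 * t * deviation / (n * s) \<le> error"
proof -
  define X where "X = c ^ 3 * \<delta> ^ 3 / (q ^ 5 * r ^ 5 * t\<^sup>2)"
  \<comment> \<open>By \<open>t \<le> w\<close> the diagonal corrections join the fluctuation term:
    \<open>30 + 12 = 42\<close>, and \<open>8 * 42 = 336\<close>.\<close>
  have "12 * N * t\<^sup>2 \<le> 12 * N * t * w"
    using mult_left_mono[OF w_ge, of "12 * N * t"] n_le_N n t_pos by (simp add: power2_eq_square)
  then have "8 * (30 * N * t * w + 12 * N * t\<^sup>2) / (n * s)\<^sup>2 \<le> 8 * (42 * N * t * w) / (n * s)\<^sup>2"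
    by (intro divide_right_mono) auto
  also have "\<dots> = 336 * (q ^ 7 * r ^ 6 * t * w / n / (q ^ 5 * r ^ 5 * t\<^sup>2))"
    using n s q r by (simp add: t_eq N_eq field_simps power2_eq_square eval_nat_numeral)
  also have "\<dots> \<le> 336 * (c ^ 3 * \<delta> ^ 3 / (q ^ 5 * r ^ 5 * t\<^sup>2))"
    using K1 n q r t_pos by (intro mult_left_mono divide_right_mono) (auto simp: pos_divide_le_eq)
  finally have 1: "8 * (30 * N * t * w + 12 * N * t\<^sup>2) / (n * s)\<^sup>2 \<le> 336 * X" by (simp add: X_def)
  have "2 * t * deviation / (n * s) \<le> 2 * t * (6 * r * sqrt n * w) / (n * s)"
    using deviation_le n s t_pos by (intro divide_right_mono mult_left_mono) auto
  also have "\<dots> = 12 * (q * r * w * (sqrt n / n))"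
    using s by (simp add: t_eq field_simps)
  also have "sqrt n / n = 1 / sqrt n" using n by (simp add: field_simps)
  \<comment> \<open>One power of \<open>q\<close> is given away so that both contributions have the
    denominator \<open>q^5 r^5 t^2\<close>.\<close>
  also have "12 * (q * r * w * (1 / sqrt n)) \<le> 12 * (q\<^sup>2 * r * w * (1 / sqrt n))"
    using q r w n by (intro mult_left_mono mult_right_mono) (auto intro: self_le_power)
  also have "\<dots> = 12 * (q ^ 7 * r ^ 6 * t\<^sup>2 * w / sqrt n / (q ^ 5 * r ^ 5 * t\<^sup>2))"
    using n s q r by (simp add: t_eq N_eq field_simps power2_eq_square eval_nat_numeral)
  also have "\<dots> \<le> 12 * (c ^ 3 * \<delta> ^ 3 / (q ^ 5 * r ^ 5 * t\<^sup>2))"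
    using K2 n q r t_pos by (intro mult_left_mono divide_right_mono) (auto simp: pos_divide_le_eq)
  finally have "2 * t * deviation / (n * s) \<le> 12 * X" by (simp add: X_def)
  moreover have "error = 336 * X + 12 * X" by (simp add: error_def X_def mult_ac)
  ultimately show ?thesis using 1 by linarith
qed

lemma error_pos: "0 \<le> error" using c \<delta> q r by (simp add: error_def)

definition gap :: real where "gap = \<delta> ^ 3 / (8 * r\<^sup>2 * t\<^sup>2)"

lemma gap_pos: "0 < gap" using \<delta> r t_pos by (simp add: gap_def)

text \<open>The weight \<open>r q^2\<close> is the one that survives in the comparison of
  thresholds. The left side is \<open>2784 c^3 gap / (q^3 r^2)\<close>, where
  \<open>2784 = 8 * 348\<close>.\<close>

lemma error_le_gap: "r * q\<^sup>2 * error \<le> 2784 * c ^ 3 * gap"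
proof -
  have "r * q\<^sup>2 * error = 348 * c ^ 3 * (\<delta> ^ 3 / t\<^sup>2) * (1 / (q ^ 3 * r ^ 4))"
    using q r t_pos by (simp add: error_def field_simps eval_nat_numeral)
  also have "\<dots> \<le> 348 * c ^ 3 * (\<delta> ^ 3 / t\<^sup>2) * (1 / r\<^sup>2)"
  proof (intro mult_left_mono frac_le)
    have "1 * r\<^sup>2 \<le> q ^ 3 * r ^ 4" using q r by (intro mult_mono power_increasing) auto
    then show "r\<^sup>2 \<le> q ^ 3 * r ^ 4" by simp
  qed (use c \<delta> r in auto)
  also have "\<dots> = 2784 * c ^ 3 * gap" using r t_pos by (simp add: gap_def field_simps)
  finally show ?thesis .
qed

lemma error_small: "error \<le> c * s"
proof -
  have "error \<le> 348 * (c ^ 3 * \<delta> ^ 3) / t\<^sup>2"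
  proof -
    have "1 * 1 \<le> q ^ 5 * r ^ 5" using q r by (intro mult_mono) auto
    then have "t\<^sup>2 \<le> q ^ 5 * r ^ 5 * t\<^sup>2" using mult_right_mono[of 1 "q ^ 5 * r ^ 5" "t\<^sup>2"] by simp
    then show ?thesis unfolding error_def using c \<delta> t_pos by (intro frac_le) auto
  qed
  also have "\<dots> \<le> 348 * (c ^ 3 * (t\<^sup>2 * s)) / t\<^sup>2"
    using delta_cubed c by (intro divide_right_mono mult_left_mono) auto
  also have "\<dots> = (348 * (c * c)) * (c * s)" using t_pos by (simp add: power3_eq_cube)
  also have "\<dots> \<le> 1 * (c * s)"
    using mult_mono[OF c(2) c(2)] c s by (intro mult_right_mono) auto
  finally show ?thesis by simp
qed

lemma error_quarter: "error \<le> s / 4"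
  using error_small mult_right_mono[OF c(2), of s] s by linarith

lemma error_le_gap': "8 * error \<le> gap"
proof -
  have "1 * 1 \<le> r * q\<^sup>2" using r q by (intro mult_mono) auto
  then have "error \<le> r * q\<^sup>2 * error" using error_pos mult_right_mono[of 1 "r * q\<^sup>2" error] by simp
  also note error_le_gap
  also have "2784 * c ^ 3 * gap \<le> 2784 * (1 / 1000000000) * gap"
    using c_cubed gap_pos by (intro mult_right_mono mult_left_mono) auto
  finally show ?thesis using gap_pos by linarith
qed

text \<open>After removal of a common factor the claim compares
  \<open>432 * 1536 * r^2 q^3 error^2\<close> with \<open>500 c gap^2\<close>. The square of
  \<open>error_le_gap\<close> carries \<open>c^6\<close> against the single \<open>c\<close> of the
  margin \<open>500 c\<close>, and the spare \<open>c^5\<close> outweighs the constants.\<close>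

lemma thresholds_separated:
  "12 * (3 * N * t)\<^sup>2 * error\<^sup>2 / (s / 4 * (500 * c)) < (n * s)\<^sup>2 / 8 * (gap / 2)\<^sup>2 / (24 * (2 * t))"
proof -
  \<comment> \<open>Raising \<open>q^3\<close> to \<open>q^4\<close> completes the square
    \<open>(r q^2 error)^2\<close>.\<close>
  have "r\<^sup>2 * q ^ 3 * error\<^sup>2 \<le> r\<^sup>2 * q ^ 4 * error\<^sup>2"
    using q r by (intro mult_right_mono mult_left_mono power_increasing) auto
  also have "\<dots> = (r * q\<^sup>2 * error)\<^sup>2" by (simp add: power_mult_distrib)
  also have "\<dots> \<le> (2784 * c ^ 3 * gap)\<^sup>2"
    using error_le_gap error_pos r by (intro power_mono) auto
  also have "\<dots> = 2784\<^sup>2 * (c ^ 3 * c\<^sup>2) * c * gap\<^sup>2" by (simp add: power_mult_distrib eval_nat_numeral)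
  also have "\<dots> \<le> 2784\<^sup>2 * (1 / 1000000000 * (1 / 1000)\<^sup>2) * c * gap\<^sup>2"
    using c c_cubed by (intro mult_right_mono mult_left_mono mult_mono power_mono) auto
  also have "\<dots> < 500 / (432 * 1536) * c * gap\<^sup>2"
    using c gap_pos by (intro mult_strict_right_mono) (auto simp: power2_eq_square)
  finally have main: "432 * 1536 * (r\<^sup>2 * q ^ 3 * error\<^sup>2) < 500 * c * gap\<^sup>2" by (simp add: mult_ac)
  have "12 * (3 * N * t)\<^sup>2 * error\<^sup>2 / (s / 4 * (500 * c))
      = (432 * 1536 * (r\<^sup>2 * q ^ 3 * error\<^sup>2)) * (n\<^sup>2 * s / (1536 * q * (500 * c)))"
    using s c q by (simp add: t_eq N_eq field_simps eval_nat_numeral)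
  also have "\<dots> < (500 * c * gap\<^sup>2) * (n\<^sup>2 * s / (1536 * q * (500 * c)))"
    using main n s c q by (intro mult_strict_right_mono) auto
  also have "\<dots> = (n * s)\<^sup>2 / 8 * (gap / 2)\<^sup>2 / (24 * (2 * t))"
    using s c q by (simp add: t_eq N_eq field_simps eval_nat_numeral)
  finally show ?thesis .
qed

end

section \<open>Exact recovery\<close>

lemma (in sized_two_block_model) exact_recovery_prob:
  assumes \<kappa>: "\<kappa> < 1" "t < \<kappa>" and c: "c = (1 - \<kappa>) / 1000"
    and regime: "separation_regime n N (N / n) s t (t / s) (s - \<rho>) (ln n) c (sqrt (t * ln n))"
  shows "\<exists>thr. 1 - 32 / n\<^sup>2 \<le> measure_pmf.prob (sbm_pmf C1 C2 \<theta>1 \<theta>2 \<rho>)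
    {Y. \<forall>i\<in>V. \<forall>j\<in>V. awcd1 V thr Y i j = true_weight C1 C2 i j}"
proof -
  define w where "w = sqrt (t * ln n)"
  interpret R: separation_regime n N "N / n" s t "t / s" "s - \<rho>" "ln n" c w
    using regime by (simp add: w_def)
  define u where "u = 30 * N * t * w"
  \<comment> \<open>The threshold is the within-block upper bound itself, with margin
    \<open>hi = 500 c\<close>; \<open>thresholds_separated\<close> puts the between-block lower
    bound strictly above it.\<close>
  define thr where "thr = 12 * (3 * N * t)\<^sup>2 * R.error\<^sup>2 / (s / 4 * (500 * c))"
  let ?rec = "{Y. \<forall>i\<in>V. \<forall>j\<in>V. awcd1 V thr Y i j = true_weight C1 C2 i j}"
  let ?good = "{g. good_degrees g R.deviation \<and> good_S g u}"
  have "R.error \<le> c * s" by (rule R.error_small)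
  also have "c * s \<le> c" using R.c params by (simp add: mult_le_cancel_left2)
  finally have "R.error \<le> c" .
  \<comment> \<open>Since \<open>1 - t > 1000 c\<close> and the error is at most \<open>c\<close>, a
    distance of \<open>500 c\<close> from 1 remains.\<close>
  moreover have "1000 * c = 1 - \<kappa>" by (simp add: c)
  ultimately have error: "t + R.error < 1" "t + R.error + 500 * c \<le> 1" "0 < 500 * c"
    using \<kappa> by linarith+
  have gap: "R.gap = n\<^sup>2 * (s - \<rho>) ^ 3 / (8 * N\<^sup>2 * t\<^sup>2)"
    using params n_pos by (simp add: R.gap_def field_simps power2_eq_square)
  have bound: "8 * (u + 12 * N * t\<^sup>2) / (n * s)\<^sup>2 + 2 * t * R.deviation / (n * s) \<le> R.error"
    unfolding u_def by (rule R.error_bound)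
  have recover: "adj g \<in> ?rec" if g: "good_degrees g R.deviation" "good_S g u" for g
  proof (intro CollectI ballI)
    fix i j assume ij: "i \<in> V" "j \<in> V"
    consider "true_weight C1 C2 i j = 1" | "true_weight C1 C2 i j = 0"
      unfolding true_weight_def of_bool_def by meson
    then show "awcd1 V thr (adj g) i j = true_weight C1 C2 i j"
    proof cases
      case 1
      have "awcd_T V (adj g) i j \<le> thr"
        unfolding thr_def
        by (rule awcd_T_same_block_le[OF g(1) R.deviation_small R.ns_ge g(2) ij 1 bound
              error(2,3) R.error_quarter])
      then show ?thesis by (simp add: awcd1_def 1)
    next
      case 2
      have "thr < awcd_T V (adj g) i j"
        unfolding thr_def
        by (rule order.strict_trans2[OF R.thresholds_separated
              awcd_T_distinct_blocks_ge[OF g(1) R.deviation_small R.ns_ge g(2) ij 2 bound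
                error(1) R.error_quarter gap R.error_le_gap']])
      then show ?thesis by (simp add: awcd1_def 2)
    qed
  qed
  have L: "1 \<le> ln n" by (rule R.L)
  have "measure_pmf.prob graph_pmf (- ?good) \<le> 32 * N\<^sup>2 * exp (- 6 * ln n)"
    using good_event_prob[OF L R.L_le_degree R.L_le_wedges R.deviation_def R.deviation_small R.ns_ge, of u]
    by (simp add: u_def w_def Compl_eq)
  \<comment> \<open>The bound \<open>N \<le> n^2\<close> turns the union bound into
    \<open>n^4\<close> against the tail \<open>n^(-6)\<close>.\<close>
  also have "\<dots> \<le> 32 * (n\<^sup>2)\<^sup>2 * exp (- 6 * ln n)"
    using R.N_le params by (intro mult_right_mono mult_left_mono power_mono) auto
  also have "exp (- 6 * ln n) = 1 / n ^ 6"
  proof -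
    have "exp (6 * ln n) = exp (ln n) ^ 6" by (rule exp_of_nat_mult[of 6, simplified])
    then show ?thesis using n_pos by (simp add: exp_minus field_simps)
  qed
  also have "32 * (n\<^sup>2)\<^sup>2 * (1 / n ^ 6) = 32 / n\<^sup>2"
    using n_pos by (simp add: field_simps eval_nat_numeral)
  finally have "1 - 32 / n\<^sup>2 \<le> measure_pmf.prob graph_pmf ?good"
    using measure_pmf.prob_compl[of ?good graph_pmf] by (simp add: Compl_eq_Diff_UNIV)
  also have "\<dots> \<le> measure_pmf.prob graph_pmf (adj -` ?rec)"
    using recover by (intro measure_pmf.finite_measure_mono) auto
  also have "\<dots> = measure_pmf.prob (sbm_pmf C1 C2 \<theta>1 \<theta>2 \<rho>) ?rec"
    by (simp add: sbm_pmf_def graph_pmf_def)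
  finally show ?thesis by blast
qed

text \<open>Cubing turns the exponents \<open>7/3\<close> and \<open>2\<close> into 7 and 6 and the
  two branches of the maximum into \<open>t w / n\<close> and \<open>t^2 w / sqrt n\<close>, where
  \<open>w = sqrt (t ln n)\<close>. The bound \<open>exp 1 \<le> n\<close> makes \<open>ln n\<close>
  at least 1.\<close>

lemma separation_regime_intro:
  fixes n N s t \<rho> c :: real
  assumes n: "exp 1 \<le> n" "n \<le> N" and p: "0 \<le> \<rho>" "\<rho> < s" "s \<le> t" "t \<le> 1"
    and c: "0 < c" "c \<le> 1 / 1000"
    and sep: "c * (s - \<rho>) > (t / s) powr (7/3) * (N / n)\<^sup>2 *
           max (n powr (-1/3) * t powr (1/2) * ln n powr (1/6))
               (n powr (-1/6) * t powr (5/6) * ln n powr (1/6))"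
  shows "separation_regime n N (N / n) s t (t / s) (s - \<rho>) (ln n) c (sqrt (t * ln n))"
proof -
  have n1: "1 \<le> n" using n(1) exp_ge_add_one_self[of 1] by linarith
  have L: "1 \<le> ln n" using n(1) n1 by (simp add: ln_ge_iff)
  have pos: "0 < n" "0 < s" "0 < t" "0 < t / s" using n1 p by auto
  have ln_pos: "0 < ln n" using L by linarith
  have cube: "(x powr a) ^ 3 = x powr (3 * a)" if "0 < x" for x a :: real
    using that by (simp add: powr_power mult.commute)
  define q where "q = (t / s) powr (7/3) * (N / n)\<^sup>2"
  have q0: "0 \<le> q" by (simp add: q_def)
  have q3: "q ^ 3 = (t / s) ^ 7 * (N / n) ^ 6"
    using cube[OF pos(4), of "7/3"] powr_realpow[OF pos(4), of 7]
    unfolding q_def power_mult_distrib by (simp flip: power_mult)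
  have branch: "q ^ 3 * A ^ 3 \<le> c ^ 3 * (s - \<rho>) ^ 3"
    if "0 \<le> A" "A \<le> max (n powr (-1/3) * t powr (1/2) * ln n powr (1/6))
               (n powr (-1/6) * t powr (5/6) * ln n powr (1/6))" for A
  proof -
    have "q * A \<le> c * (s - \<rho>)"
      using sep mult_left_mono[OF that(2) q0] unfolding q_def by linarith
    then have "(q * A) ^ 3 \<le> (c * (s - \<rho>)) ^ 3"
      using q0 that(1) by (intro power_mono) auto
    then show ?thesis by (simp add: power_mult_distrib)
  qed
  have half: "ln n powr (1 / 2) = sqrt (ln n)" using ln_pos by (simp add: powr_half_sqrt)
  have A1: "(n powr (-1/3) * t powr (1/2) * ln n powr (1/6)) ^ 3 = t * sqrt (t * ln n) / n"
  proof -
    have "t powr (3 / 2) = t * sqrt t"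
      using powr_add[of t 1 "1 / 2"] pos by (simp add: powr_half_sqrt)
    moreover have "n powr (-1) = 1 / n" using pos by (simp add: powr_minus_divide)
    ultimately show ?thesis
      unfolding power_mult_distrib cube[OF pos(1)] cube[OF pos(3)] cube[OF ln_pos]
      by (simp add: half real_sqrt_mult)
  qed
  have A2: "(n powr (-1/6) * t powr (5/6) * ln n powr (1/6)) ^ 3 = t\<^sup>2 * sqrt (t * ln n) / sqrt n"
  proof -
    have "t powr (5 / 2) = t\<^sup>2 * sqrt t"
      using powr_add[of t 2 "1 / 2"] pos by (simp add: powr_half_sqrt)
    moreover have "n powr (- (1 / 2)) = 1 / sqrt n" using pos by (simp add: powr_minus_divide powr_half_sqrt)
    ultimately show ?thesis
      unfolding power_mult_distrib cube[OF pos(1)] cube[OF pos(3)] cube[OF ln_pos]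
      by (simp add: half real_sqrt_mult)
  qed
  show ?thesis
  proof
    show "(t / s) ^ 7 * (N / n) ^ 6 * t * sqrt (t * ln n) \<le> c ^ 3 * (s - \<rho>) ^ 3 * n"
      using branch[OF _ max.cobounded1] pos unfolding A1 q3 by (simp add: pos_divide_le_eq mult_ac)
    show "(t / s) ^ 7 * (N / n) ^ 6 * t\<^sup>2 * sqrt (t * ln n) \<le> c ^ 3 * (s - \<rho>) ^ 3 * sqrt n"
      using branch[OF _ max.cobounded2] pos unfolding A2 q3 by (simp add: pos_divide_le_eq mult_ac)
  qed (use n n1 p c pos L ln_pos in auto)
qed

theorem proposition2:
  fixes \<kappa> :: real
  assumes "0 < \<kappa>" and "\<kappa> < 1"
  shows "\<exists>c::real. c > 0 \<and>
    (\<forall>(C1 :: nat \<Rightarrow> nat set) (C2 :: nat \<Rightarrow> nat set)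
      (n1 :: nat \<Rightarrow> nat) (n2 :: nat \<Rightarrow> nat) (nmin :: nat \<Rightarrow> nat) (nmax :: nat \<Rightarrow> nat)
      (\<theta>1 :: nat \<Rightarrow> real) (\<theta>2 :: nat \<Rightarrow> real) (\<rho> :: nat \<Rightarrow> real)
      (\<theta>min :: nat \<Rightarrow> real) (\<theta>max :: nat \<Rightarrow> real).
      (\<forall>k. finite (C1 k) \<and> finite (C2 k) \<and> C1 k \<inter> C2 k = {} \<and>
           n1 k = card (C1 k) \<and> n2 k = card (C2 k) \<and>
           nmin k = min (n1 k) (n2 k) \<and> nmax k = max (n1 k) (n2 k) \<and>
           \<theta>min k = min (\<theta>1 k) (\<theta>2 k) \<and> \<theta>max k = max (\<theta>1 k) (\<theta>2 k)) \<longrightarrow>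
      (\<forall>k. \<theta>1 k > \<rho> k \<and> \<theta>2 k > \<rho> k \<and> \<rho> k \<ge> 0) \<longrightarrow>
      filterlim nmin at_top sequentially \<longrightarrow>
      (\<forall>k. \<theta>max k < \<kappa>) \<longrightarrow>
      (\<forall>k. c * (\<theta>min k - \<rho> k) >
           (\<theta>max k / \<theta>min k) powr (7/3) * (real (nmax k) / real (nmin k))\<^sup>2 *
           max (real (nmin k) powr (-1/3) * \<theta>max k powr (1/2) * ln (real (nmin k)) powr (1/6))
               (real (nmin k) powr (-1/6) * \<theta>max k powr (5/6) * ln (real (nmin k)) powr (1/6))) \<longrightarrow>
      (\<exists>thr :: nat \<Rightarrow> real.
        (\<lambda>k. measure_pmf.prob (sbm_pmf (C1 k) (C2 k) (\<theta>1 k) (\<theta>2 k) (\<rho> k))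
               {Y. \<forall>i \<in> C1 k \<union> C2 k. \<forall>j \<in> C1 k \<union> C2 k.
                     awcd1 (C1 k \<union> C2 k) (thr k) Y i j = true_weight (C1 k) (C2 k) i j})
        \<longlonglongrightarrow> 1))"
proof (intro exI[of _ "(1 - \<kappa>) / 1000"] conjI allI impI)
  show "0 < (1 - \<kappa>) / 1000" using assms by simp
next
  fix C1 C2 :: "nat \<Rightarrow> nat set" and n1 n2 nmin nmax :: "nat \<Rightarrow> nat"
    and \<theta>1 \<theta>2 \<rho> \<theta>min \<theta>max :: "nat \<Rightarrow> real"
  \<comment> \<open>Through \<open>c\<close>, \<open>\<kappa>\<close> controls the distance of the
    estimators from 1, where the upper bound for the relative entropy degenerates.\<close>
  define c where "c = (1 - \<kappa>) / 1000"
  let ?prob = "\<lambda>k thr. measure_pmf.prob (sbm_pmf (C1 k) (C2 k) (\<theta>1 k) (\<theta>2 k) (\<rho> k))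
    {Y. \<forall>i \<in> C1 k \<union> C2 k. \<forall>j \<in> C1 k \<union> C2 k.
       awcd1 (C1 k \<union> C2 k) thr Y i j = true_weight (C1 k) (C2 k) i j}"
  assume sizes: "\<forall>k. finite (C1 k) \<and> finite (C2 k) \<and> C1 k \<inter> C2 k = {} \<and>
           n1 k = card (C1 k) \<and> n2 k = card (C2 k) \<and>
           nmin k = min (n1 k) (n2 k) \<and> nmax k = max (n1 k) (n2 k) \<and>
           \<theta>min k = min (\<theta>1 k) (\<theta>2 k) \<and> \<theta>max k = max (\<theta>1 k) (\<theta>2 k)"
    and assortative: "\<forall>k. \<theta>1 k > \<rho> k \<and> \<theta>2 k > \<rho> k \<and> \<rho> k \<ge> 0"
    and growth: "filterlim nmin at_top sequentially"
    and sparse: "\<forall>k. \<theta>max k < \<kappa>"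
    and sep: "\<forall>k. (1 - \<kappa>) / 1000 * (\<theta>min k - \<rho> k) >
           (\<theta>max k / \<theta>min k) powr (7/3) * (real (nmax k) / real (nmin k))\<^sup>2 *
           max (real (nmin k) powr (-1/3) * \<theta>max k powr (1/2) * ln (real (nmin k)) powr (1/6))
               (real (nmin k) powr (-1/6) * \<theta>max k powr (5/6) * ln (real (nmin k)) powr (1/6))"
  have c: "0 < c" "c \<le> 1 / 1000" using assms by (auto simp: c_def)
  \<comment> \<open>From size 3 on, \<open>nmin k \<ge> exp 1\<close>, so its logarithm is at least
    1.\<close>
  have recovery: "\<exists>thr. 1 - 32 / (real (nmin k))\<^sup>2 \<le> ?prob k thr" if k: "3 \<le> nmin k" for k
  proof -
    have \<theta>: "\<rho> k < \<theta>min k" "\<theta>min k \<le> \<theta>max k" "\<theta>max k < \<kappa>" "0 \<le> \<rho> k" "\<theta>1 k \<le> 1" "\<theta>2 k \<le> 1"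
      using sizes[rule_format, of k] assortative[rule_format, of k] sparse[rule_format, of k] assms by auto
    interpret sized_two_block_model "C1 k" "C2 k" "\<theta>1 k" "\<theta>2 k" "\<rho> k" "real (nmin k)" "real (nmax k)"
      "\<theta>min k" "\<theta>max k"
      using sizes[rule_format, of k] assortative[rule_format, of k] \<theta> k
      by unfold_locales (auto simp: of_nat_min of_nat_max)
    have "exp 1 \<le> real (nmin k)" using exp_le k by (intro order.trans[OF exp_le]) simp
    then have "separation_regime (nmin k) (nmax k) (real (nmax k) / real (nmin k)) (\<theta>min k) (\<theta>max k)
        (\<theta>max k / \<theta>min k) (\<theta>min k - \<rho> k) (ln (nmin k)) c (sqrt (\<theta>max k * ln (nmin k)))"
      using sep[rule_format, of k] params \<theta> c assms
      by (intro separation_regime_intro) (auto simp: c_def)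
    then show ?thesis
      using \<theta> assms by (intro exact_recovery_prob) (auto simp: c_def)
  qed
  \<comment> \<open>For the finitely many \<open>k\<close> with \<open>nmin k < 3\<close> the chosen
    threshold may be arbitrary; the limit does not see them.\<close>
  define thr where "thr = (\<lambda>k. SOME x. 1 - 32 / (real (nmin k))\<^sup>2 \<le> ?prob k x)"
  have "\<forall>\<^sub>F k in sequentially. 3 \<le> nmin k" using growth by (simp add: filterlim_at_top)
  then have lower: "\<forall>\<^sub>F k in sequentially. 1 - 32 / (real (nmin k))\<^sup>2 \<le> ?prob k (thr k)"
    by eventually_elim (unfold thr_def, rule someI_ex[OF recovery])
  have "filterlim (\<lambda>k. real (nmin k)) at_top sequentially"
    by (rule filterlim_compose[OF filterlim_real_sequentially growth])
  then have "((\<lambda>k. 1 - 32 / (real (nmin k))\<^sup>2) \<longlongrightarrow> 1 - 0) sequentially"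
    by (intro tendsto_diff tendsto_const real_tendsto_divide_at_top filterlim_pow_at_top) auto
  then have "(\<lambda>k. ?prob k (thr k)) \<longlonglongrightarrow> 1"
    by (intro tendsto_sandwich[OF lower _ _ tendsto_const]) (auto intro: always_eventually)
  then show "\<exists>thr. (\<lambda>k. ?prob k (thr k)) \<longlonglongrightarrow> 1" by blast
qed

end
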